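(* Let $\pi\in\mathfrak S_n$ avoid the pattern $312$, and let $m\in[n]$ be such that $\pi_m=1$. Then $\pi=12[21[\pi',1],\pi'']$ for $312$-avoiding permutations $\pi'$ and $\pi''$ with $|\pi'|=m-1$ and $|\pi''|=n-m$. Moreover, (i) $\operatorname{diam}(G_{\pi})=\operatorname{diam}(G_{\pi'})+\operatorname{diam}(G_{\pi''})+(m-1)(\ell(\pi')+\ell(\pi''))+\ell(\pi')(\ell(\pi'')-1)$; (ii) $\operatorname{diam}(C_{\pi})=\operatorname{diam}(C_{\pi'})+\operatorname{diam}(C_{\pi''})+\ell(\pi')$; (iii) $\operatorname{diam}(B_{\pi})=\operatorname{diam}(B_{\pi'})+\operatorname{diam}(B_{\pi''})+(m-1)(\ell(\pi')+\ell(\pi''))+\ell(\pi')(\ell(\pi'')-2)$.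
   Context: A permutation $\pi$ contains a pattern $\sigma$ if some subsequence of its one-line notation is order isomorphic to $\sigma$, and avoids $\sigma$ otherwise. $|\pi|$ is the size of $\pi$ (so $\pi\in\mathfrak S_{|\pi|}$; size $0$ is allowed). For $\alpha\in\mathfrak S_a$, $\beta\in\mathfrak S_b$: $12[\alpha,\beta]=\alpha_1\cdots\alpha_a(\beta_1+a)\cdots(\beta_b+a)$ and $21[\alpha,\beta]=(\alpha_1+b)\cdots(\alpha_a+b)\beta_1\cdots\beta_b$. For $\pi\in\mathfrak S_n$, $\ell(\pi)$ is the number of inversions, and $R(\pi)$ is the set of reduced words: words $r_1\cdots r_{\ell(\pi)}$ in $[n-1]$ with $\pi=s_{r_1}\cdots s_{r_{\ell(\pi)}}$, $s_i=(i,i+1)$. A commutation move exchanges adjacent letters $jk$ with $|j-k|>1$; a long braid move replaces consecutive $j(j+1)j$ by $(j+1)j(j+1)$ or vice versa. $G_\pi$ is the graph on $R(\pi)$ with edges given by single commutation or long braid moves; $C_\pi$ is $G_\pi$ with commutation edges contracted; $B_\pi$ is $G_\pi$ with long braid edges contracted. Diameter = maximum distance between two vertices (one-vertex graph: $0$). *)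

theory Defs
  imports "HOL-Combinatorics.Permutations" "Graph_Theory.Graph_Theory"
begin

text \<open>
  A permutation of size \<open>n\<close> is a function \<open>p :: nat \<Rightarrow> nat\<close> with \<open>p permutes {1..n}\<close>. Such a function
  also permutes every larger interval, so the size is always passed explicitly, in front of the
  permutation.
\<close>

definition one_line :: "nat list \<Rightarrow> nat \<Rightarrow> nat" where
  "one_line xs = (\<lambda>i. if i \<in> {1..length xs} then xs ! (i - 1) else i)"

definition contains_pattern :: "nat \<Rightarrow> (nat \<Rightarrow> nat) \<Rightarrow> nat \<Rightarrow> (nat \<Rightarrow> nat) \<Rightarrow> bool" where
  "contains_pattern n p k q \<longleftrightarrow>
     (\<exists>e. strict_mono_on {1..k} e \<and> e ` {1..k} \<subseteq> {1..n} \<and>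
          (\<forall>i\<in>{1..k}. \<forall>j\<in>{1..k}. p (e i) < p (e j) \<longleftrightarrow> q i < q j))"

abbreviation avoids_312 :: "nat \<Rightarrow> (nat \<Rightarrow> nat) \<Rightarrow> bool" where
  "avoids_312 n p \<equiv> \<not> contains_pattern n p 3 (one_line [3, 1, 2])"

text \<open>The inflations \<open>12[p, q]\<close> and \<open>21[p, q]\<close> of \<open>p\<close> of size \<open>a\<close> and \<open>q\<close> of size \<open>b\<close>.\<close>

definition inflate_12 :: "nat \<Rightarrow> (nat \<Rightarrow> nat) \<Rightarrow> nat \<Rightarrow> (nat \<Rightarrow> nat) \<Rightarrow> nat \<Rightarrow> nat" where
  "inflate_12 a p b q = (\<lambda>i. if i \<in> {1..a} then p i
                             else if i \<in> {a + 1..a + b} then q (i - a) + a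
                             else i)"

definition inflate_21 :: "nat \<Rightarrow> (nat \<Rightarrow> nat) \<Rightarrow> nat \<Rightarrow> (nat \<Rightarrow> nat) \<Rightarrow> nat \<Rightarrow> nat" where
  "inflate_21 a p b q = (\<lambda>i. if i \<in> {1..a} then p i + b
                             else if i \<in> {a + 1..a + b} then q (i - a)
                             else i)"

definition inversion_number :: "nat \<Rightarrow> (nat \<Rightarrow> nat) \<Rightarrow> nat" where
  "inversion_number n p = card {(i, j). i \<in> {1..n} \<and> j \<in> {1..n} \<and> i < j \<and> p j < p i}"

text \<open>Products of permutations are compositions of functions, the rightmost factor acting first.\<close>

definition reduced_words :: "nat \<Rightarrow> (nat \<Rightarrow> nat) \<Rightarrow> nat list set" where
  "reduced_words n p =
     {w. set w \<subseteq> {1..<n} \<and> length w = inversion_number n p \<and>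
         p = foldr (\<circ>) (map (\<lambda>r. transpose r (r + 1)) w) id}"

definition commutation_moves :: "nat list rel" where
  "commutation_moves =
     {(u @ [j, k] @ v, u @ [k, j] @ v) | u v j k. \<bar>int j - int k\<bar> > 1}"

definition braid_moves :: "nat list rel" where
  "braid_moves =
     {(u @ [j, j + 1, j] @ v, u @ [j + 1, j, j + 1] @ v) | u v j. True} \<union>
     {(u @ [j + 1, j, j + 1] @ v, u @ [j, j + 1, j] @ v) | u v j. True}"

text \<open>
  Undirected graphs are symmetric loop-free digraphs, as in the locale \<open>pair_graph\<close>.
\<close>

definition word_graph :: "nat \<Rightarrow> (nat \<Rightarrow> nat) \<Rightarrow> nat list pair_pre_digraph" where
  "word_graph n p =
     \<lparr> pverts = reduced_words n p,
       parcs = (commutation_moves \<union> braid_moves) \<inter> reduced_words n p \<times> reduced_words n p \<rparr>"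

text \<open>
  Contracting the edges of \<open>G\<close> that lie in \<open>F\<close>: the vertices of the result are the connected components
  of \<open>G\<close> restricted to these edges. Loops and multiplicities of edges, which do not influence
  distances, are discarded.
\<close>

definition contraction_rel :: "'a pair_pre_digraph \<Rightarrow> 'a rel \<Rightarrow> 'a rel" where
  "contraction_rel G F = (parcs G \<inter> F)\<^sup>* \<inter> pverts G \<times> pverts G"

definition contract_edges :: "'a pair_pre_digraph \<Rightarrow> 'a rel \<Rightarrow> 'a set pair_pre_digraph" where
  "contract_edges G F =
     \<lparr> pverts = pverts G // contraction_rel G F,
       parcs = {(X, Y). X \<in> pverts G // contraction_rel G F \<and> Y \<in> pverts G // contraction_rel G F \<and>
                        X \<noteq> Y \<and> (\<exists>x\<in>X. \<exists>y\<in>Y. (x, y) \<in> parcs G)} \<rparr>"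

definition commutation_contracted_graph :: "nat \<Rightarrow> (nat \<Rightarrow> nat) \<Rightarrow> nat list set pair_pre_digraph" where
  "commutation_contracted_graph n p = contract_edges (word_graph n p) commutation_moves"

definition braid_contracted_graph :: "nat \<Rightarrow> (nat \<Rightarrow> nat) \<Rightarrow> nat list set pair_pre_digraph" where
  "braid_contracted_graph n p = contract_edges (word_graph n p) braid_moves"

text \<open>
  With unit weights, \<open>wf_digraph.\<mu>\<close> is the least number of edges of a walk between two vertices, and
  \<open>\<infinity>\<close> if there is none.
\<close>

definition diameter_of :: "'a pair_pre_digraph \<Rightarrow> ereal" where
  "diameter_of G = (SUP (u, v) \<in> pverts G \<times> pverts G. wf_digraph.\<mu> (with_proj G) (\<lambda>_. 1) u v)"

lemma finite_reduced_words: "finite (reduced_words n p)"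
proof (rule finite_subset)
  show "reduced_words n p \<subseteq> {w. set w \<subseteq> {1..<n} \<and> length w = inversion_number n p}"
    by (auto simp: reduced_words_def)
qed (simp add: finite_lists_length_eq)

lemma sym_commutation_moves: "sym commutation_moves"
proof (rule symI)
  fix x y assume "(x, y) \<in> commutation_moves"
  then obtain u v j k where "x = u @ [j, k] @ v" "y = u @ [k, j] @ v" "\<bar>int k - int j\<bar> > 1"
    unfolding commutation_moves_def by (auto simp: abs_minus_commute)
  then show "(y, x) \<in> commutation_moves"
    unfolding commutation_moves_def by blast
qed

lemma sym_braid_moves: "sym braid_moves"
  unfolding sym_def braid_moves_def by blast

lemma pair_graphI:
  assumes "finite (pverts G)" "parcs G \<subseteq> pverts G \<times> pverts G" "sym (parcs G)"
    and "\<And>x. (x, x) \<notin> parcs G"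
  shows "pair_graph G"
proof -
  have "finite (parcs G)"
    using assms(1,2) by (meson finite_SigmaI finite_subset)
  moreover have "symmetric (with_proj G)"
    using assms(3) by (simp add: symmetric_def)
  moreover have "fst e \<in> pverts G" "snd e \<in> pverts G" "fst e \<noteq> snd e" if "e \<in> parcs G" for e
    using that assms(2,4) by (cases e; auto)+
  ultimately show ?thesis
    using assms(1)
    unfolding pair_graph_def pair_digraph_def pair_pseudo_graph_def pair_fin_digraph_def
      pair_sym_digraph_def pair_loopfree_digraph_def pair_wf_digraph_def
      pair_fin_digraph_axioms_def pair_sym_digraph_axioms_def pair_loopfree_digraph_axioms_def
    by blast
qed

lemma pair_graph_sym_parcs: "pair_graph G \<Longrightarrow> sym (parcs G)"
  using pair_sym_digraph.pair_sym_arcs[of G]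
  by (simp add: pair_graph_def pair_pseudo_graph_def symmetric_def)

lemma pair_graph_word_graph: "pair_graph (word_graph n p)"
proof (rule pair_graphI)
  have "sym (commutation_moves \<union> braid_moves)"
    by (intro sym_Un sym_commutation_moves sym_braid_moves)
  then show "sym (parcs (word_graph n p))"
    by (auto simp: word_graph_def sym_def)
  show "(x, x) \<notin> parcs (word_graph n p)" for x
    by (auto simp: word_graph_def commutation_moves_def braid_moves_def)
qed (auto simp: word_graph_def finite_reduced_words)

lemma equiv_contraction_rel:
  assumes "pair_graph G" "sym F"
  shows "equiv (pverts G) (contraction_rel G F)"
proof -
  have "sym ((parcs G \<inter> F)\<^sup>*)"
    using pair_graph_sym_parcs[OF assms(1)] assms(2) by (intro sym_rtrancl sym_Int)
  then show ?thesis
    unfolding contraction_rel_def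
    by (intro equivI) (auto simp: refl_on_def sym_def trans_def)
qed

lemma pair_graph_contract_edges:
  assumes "pair_graph G"
  shows "pair_graph (contract_edges G F)"
proof (rule pair_graphI)
  have "finite (pverts G)"
    using assms unfolding pair_graph_def pair_digraph_def
    by (blast intro: pair_fin_digraph.pair_finite_verts)
  then show "finite (pverts (contract_edges G F))"
    by (simp add: contract_edges_def finite_quotient contraction_rel_def)
  show "sym (parcs (contract_edges G F))"
    using pair_graph_sym_parcs[OF assms] unfolding contract_edges_def sym_def by auto
qed (auto simp: contract_edges_def)

end

(*
  Assign costs to commutation and long braid moves: (1, 1), (0, 1) and (1, 0) turn the diameters of
  G, C and B into diameters of weighted word graphs, so one computation settles all three.

  Reduced words of 12[p, q] are shuffles of reduced words of p and (shifted) q. Any two shuffles can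
  be joined through "all of p first" or through "all of q first"; the two detours together cost twice
  the sum of all letter swaps, so one of them costs at most that sum, and moving from one extreme to
  the other forces every swap. Reduced words of 21[p, 1] behave alike: erasing the strand of the value
  1 leaves a reduced word of p, and carrying a crossing of p from one side of that strand to the other
  takes exactly one long braid move and k - 2 commutations, k being the size of p.
*)

theory Submission
  imports Defs
begin

section \<open>Weighted distances between words\<close>

text \<open>Write \<open>a\<close> for the cost of a commutation and \<open>b\<close> for that of a
  long braid move. Both inflations are instances of one product principle: words are compared with
  pairs of smaller words by two projections and a potential \<open>h\<close>. The lower bound rests
  on one inequality per move, namely that its cost covers the projected moves and the loss of
  \<open>h\<close> together; this telescopes along every path. The effect of a move can be read off
  only because reduced words waste nothing. The letter between the two blocks never occurs in a
  reduced word of 12[p, q], since the first letter of a reduced word always undoes an inversion. The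
  strand of the value 1 never turns back, by comparison of lengths: an erased word is at least as
  long as the inversion number of its permutation, and the lengths add up with no slack. Such
  comparisons also compute the inversion numbers of the inflations. The constants are the potentials
  of an extreme word: l(p) l(q) a for 12[p, q], and l(p) ((k - 2) a + b) for 21[p, 1], which has
  l(p) + k inversions.\<close>

inductive connects :: "nat \<Rightarrow> nat \<Rightarrow> nat list \<Rightarrow> nat list \<Rightarrow> nat \<Rightarrow> bool" for a b where
  refl: "connects a b x x 0"
| comm: "(x, y) \<in> commutation_moves \<Longrightarrow> connects a b y z c \<Longrightarrow> connects a b x z (a + c)"
| braid: "(x, y) \<in> braid_moves \<Longrightarrow> connects a b y z c \<Longrightarrow> connects a b x z (b + c)"

lemma connects_trans: "connects a b x y c \<Longrightarrow> connects a b y z d \<Longrightarrow> connects a b x z (c + d)"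
  by (induction rule: connects.induct) (auto simp: add.assoc intro: connects.intros)

lemma connects_comm: "(x, y) \<in> commutation_moves \<Longrightarrow> connects a b x y a"
  using connects.comm[OF _ connects.refl] by force

lemma connects_braid: "(x, y) \<in> braid_moves \<Longrightarrow> connects a b x y b"
  using connects.braid[OF _ connects.refl] by force

lemma connects_sym: "connects a b x y c \<Longrightarrow> connects a b y x c"
proof (induction rule: connects.induct)
  case (comm x y z c)
  then show ?case
    using connects_trans[of a b z y c x a] connects_comm sym_commutation_moves
    by (metis add.commute symD)
next
  case (braid x y z c)
  then show ?case
    using connects_trans[of a b z y c x b] connects_braid sym_braid_moves
    by (metis add.commute symD)
qed (rule connects.refl)

lemma commutation_movesI: "\<bar>int j - int k\<bar> > 1 \<Longrightarrow> (u @ [j, k] @ v, u @ [k, j] @ v) \<in> commutation_moves"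
  unfolding commutation_moves_def by blast

lemma commutation_movesE:
  assumes "(x, y) \<in> commutation_moves"
  obtains u v j k where "x = u @ [j, k] @ v" "y = u @ [k, j] @ v" "\<bar>int j - int k\<bar> > 1"
  using assms unfolding commutation_moves_def by blast

lemma braid_movesI:
  "(u @ [j, j + 1, j] @ v, u @ [j + 1, j, j + 1] @ v) \<in> braid_moves"
  "(u @ [j + 1, j, j + 1] @ v, u @ [j, j + 1, j] @ v) \<in> braid_moves"
  unfolding braid_moves_def by blast+

lemma braid_movesE:
  assumes "(x, y) \<in> braid_moves"
  obtains u v j where "x = u @ [j, j + 1, j] @ v" "y = u @ [j + 1, j, j + 1] @ v"
  | u v j where "x = u @ [j + 1, j, j + 1] @ v" "y = u @ [j, j + 1, j] @ v"
  using assms unfolding braid_moves_def by blast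

lemma commutation_moves_context:
  assumes "(x, y) \<in> commutation_moves"
  shows "(u @ x @ v, u @ y @ v) \<in> commutation_moves"
proof -
  obtain u' v' j k where *: "x = u' @ [j, k] @ v'" "y = u' @ [k, j] @ v'" "\<bar>int j - int k\<bar> > 1"
    using assms by (rule commutation_movesE)
  then show ?thesis
    using commutation_movesI[OF *(3), of "u @ u'" "v' @ v"] by simp
qed

lemma braid_moves_context:
  assumes "(x, y) \<in> braid_moves"
  shows "(u @ x @ v, u @ y @ v) \<in> braid_moves"
  using assms
proof (cases rule: braid_movesE)
  case (1 u' v' j)
  then show ?thesis using braid_movesI(1)[of "u @ u'" j "v' @ v"] by simp
next
  case (2 u' v' j)
  then show ?thesis using braid_movesI(2)[of "u @ u'" j "v' @ v"] by simp
qed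

lemma connects_context: "connects a b x y c \<Longrightarrow> connects a b (u @ x @ v) (u @ y @ v) c"
  by (induction rule: connects.induct)
    (blast intro: connects.intros commutation_moves_context braid_moves_context)+

lemma connects_append_left: "connects a b x y c \<Longrightarrow> connects a b (u @ x) (u @ y) c"
  using connects_context[of a b x y c u "[]"] by simp

lemma connects_append_right: "connects a b x y c \<Longrightarrow> connects a b (x @ v) (y @ v) c"
  using connects_context[of a b x y c "[]" v] by simp

lemma connects_Cons: "connects a b x y c \<Longrightarrow> connects a b (r # x) (r # y) c"
  using connects_append_left[of a b x y c "[r]"] by simp

lemma commutation_moves_shift:
  assumes "(x, y) \<in> commutation_moves"
  shows "(map (\<lambda>r. r + d) x, map (\<lambda>r. r + d) y) \<in> commutation_moves"
proof -
  obtain u v j k where *: "x = u @ [j, k] @ v" "y = u @ [k, j] @ v" "\<bar>int j - int k\<bar> > 1"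
    using assms by (rule commutation_movesE)
  then have "\<bar>int (j + d) - int (k + d)\<bar> > 1" by simp
  from commutation_movesI[OF this] show ?thesis by (simp add: *(1,2))
qed

lemma braid_moves_shift:
  assumes "(x, y) \<in> braid_moves"
  shows "(map (\<lambda>r. r + d) x, map (\<lambda>r. r + d) y) \<in> braid_moves"
  using assms
proof (cases rule: braid_movesE)
  case (1 u v j)
  then show ?thesis
    using braid_movesI(1)[of "map (\<lambda>r. r + d) u" "j + d" "map (\<lambda>r. r + d) v"] by simp
next
  case (2 u v j)
  then show ?thesis
    using braid_movesI(2)[of "map (\<lambda>r. r + d) u" "j + d" "map (\<lambda>r. r + d) v"] by simp
qed

lemma connects_shift:
  "connects a b x y c \<Longrightarrow> connects a b (map (\<lambda>r. r + d) x) (map (\<lambda>r. r + d) y) c"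
  by (induction rule: connects.induct)
    (blast intro: connects.intros commutation_moves_shift braid_moves_shift)+

text \<open>Unconnected words get \<infinity>, in agreement with shortest walks in the graphs. Moves
  may cost zero, so distinct words can be at distance zero; these are the words that a contraction
  merges.\<close>

definition word_dist :: "nat \<Rightarrow> nat \<Rightarrow> nat list \<Rightarrow> nat list \<Rightarrow> ereal" where
  "word_dist a b x y = (INF c\<in>{c. connects a b x y c}. ereal (real c))"

definition word_diam :: "nat \<Rightarrow> nat \<Rightarrow> nat list set \<Rightarrow> ereal" where
  "word_diam a b V = (SUP (x, y)\<in>V \<times> V. word_dist a b x y)"

lemma word_dist_le: "connects a b x y c \<Longrightarrow> word_dist a b x y \<le> ereal (real c)"
  unfolding word_dist_def by (rule INF_lower) simp

text \<open>Costs are natural numbers, so the infimum is attained unless it ranges over the empty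
  set. Later arguments can thus work with an actual path of optimal cost.\<close>

lemma word_dist_cases:
  obtains c where "connects a b x y c" "word_dist a b x y = ereal (real c)"
  | "word_dist a b x y = \<infinity>"
proof (cases "\<exists>c. connects a b x y c")
  case True
  define c where "c = (LEAST c. connects a b x y c)"
  have c: "connects a b x y c"
    using True unfolding c_def by (blast intro: LeastI)
  have "ereal (real c) \<le> word_dist a b x y"
    unfolding word_dist_def c_def by (rule INF_greatest) (simp add: Least_le)
  then show ?thesis
    using that(1)[OF c] word_dist_le[OF c] by (simp add: antisym)
next
  case False
  then show ?thesis
    using that(2) by (simp add: word_dist_def top_ereal_def)
qed

lemma word_dist_nonneg: "0 \<le> word_dist a b x y"
  unfolding word_dist_def by (rule INF_greatest) simp

lemma word_dist_self: "word_dist a b x x = 0"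
  using word_dist_le[OF connects.refl, of a b x] word_dist_nonneg[of a b x x]
  by (simp add: antisym zero_ereal_def)

lemma word_dist_le_diam: "x \<in> V \<Longrightarrow> y \<in> V \<Longrightarrow> word_dist a b x y \<le> word_diam a b V"
  unfolding word_diam_def by (rule SUP_upper2[of "(x, y)"]) auto

text \<open>The supremum over finitely many pairs is a maximum, so the lower bound for a product can
  start from one extremal pair in each factor.\<close>

lemma word_diam_attained:
  assumes "finite V" "V \<noteq> {}"
  obtains x y where "x \<in> V" "y \<in> V" "word_diam a b V = word_dist a b x y"
proof -
  let ?D = "(\<lambda>(x, y). word_dist a b x y) ` (V \<times> V)"
  have "Sup ?D = Max ?D" "Max ?D \<in> ?D"
    using assms by (auto intro!: Max_Sup[symmetric] Max_in)
  then show ?thesis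
    using that unfolding word_diam_def by auto
qed

text \<open>
  Here \<open>cls\<close> sends a word to its vertex: the word itself, or its class in a contracted graph.
\<close>

lemma diameter_of_eq_word_diam:
  assumes wf: "pair_wf_digraph H"
    and verts: "pverts H = cls ` V"
    and closed: "\<And>x y. x \<in> V \<Longrightarrow> (x, y) \<in> commutation_moves \<union> braid_moves \<Longrightarrow> y \<in> V"
    and eq: "\<And>x y. x \<in> V \<Longrightarrow> y \<in> V \<Longrightarrow> cls x = cls y \<Longrightarrow> connects a b x y 0"
    and arc: "\<And>X Y. (X, Y) \<in> parcs H \<Longrightarrow> \<exists>x\<in>V. \<exists>y\<in>V. X = cls x \<and> Y = cls y \<and> connects a b x y 1"
    and comm_step: "\<And>x y. x \<in> V \<Longrightarrow> (x, y) \<in> commutation_moves \<Longrightarrow>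
      cls x = cls y \<or> 1 \<le> a \<and> (cls x, cls y) \<in> parcs H"
    and braid_step: "\<And>x y. x \<in> V \<Longrightarrow> (x, y) \<in> braid_moves \<Longrightarrow>
      cls x = cls y \<or> 1 \<le> b \<and> (cls x, cls y) \<in> parcs H"
  shows "diameter_of H = word_diam a b V"
proof -
  interpret pair_wf_digraph H by (rule wf)
  have cost: "awalk_cost (\<lambda>_. 1) p = real (length p)" for p :: "('a \<times> 'a) list"
    by (induction p) auto
  have walk_connects: "connects a b x y (length p)"
    if "awalk X p Y" "X = cls x" "Y = cls y" "x \<in> V" "y \<in> V" for X p Y x y
    using that
  proof (induction p arbitrary: X x)
    case Nil
    then show ?case using eq by (simp add: awalk_Nil_iff)
  next
    case (Cons e p)
    then have e: "(X, snd e) \<in> parcs H" and p: "awalk (snd e) p Y"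
      by (auto simp: awalk_Cons_iff)
    obtain x' z where *: "x' \<in> V" "z \<in> V" "X = cls x'" "snd e = cls z" "connects a b x' z 1"
      using arc[OF e] by blast
    \<comment> \<open>The arc may be witnessed by another representative \<open>x'\<close> of the
      class of \<open>x\<close>; passing from \<open>x\<close> to \<open>x'\<close> is free.\<close>
    have "connects a b x x' 0" using eq * Cons.prems by auto
    with * have "connects a b x z 1" using connects_trans by fastforce
    from connects_trans[OF this Cons.IH[OF p *(4) Cons.prems(3) *(2) Cons.prems(5)]]
    show ?case by simp
  qed
  \<comment> \<open>Only an inequality holds: a move inside a class adds no edge, whatever it costs,
    while an edge is charged at least one.\<close>
  have connects_walk: "\<exists>p. awalk (cls x) p (cls y) \<and> length p \<le> c"
    if "connects a b x y c" "x \<in> V" for x y c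
    using that
  proof (induction rule: connects.induct)
    case (refl x)
    then show ?case
      using verts by (intro exI[of _ "[]"]) (simp add: awalk_Nil_iff)
  next
    case (comm x y z c)
    then obtain p where p: "awalk (cls y) p (cls z)" "length p \<le> c"
      using closed by blast
    show ?case
    proof (cases "cls x = cls y")
      case True
      then show ?thesis using p by (metis trans_le_add2)
    next
      case False
      then have "1 \<le> a" "(cls x, cls y) \<in> parcs H" using comm_step comm by blast+
      then show ?thesis
        using p by (intro exI[of _ "(cls x, cls y) # p"]) (auto simp: awalk_Cons_iff)
    qed
  next
    case (braid x y z c)
    then obtain p where p: "awalk (cls y) p (cls z)" "length p \<le> c"
      using closed by blast
    show ?case
    proof (cases "cls x = cls y")
      case True
      then show ?thesis using p by (metis trans_le_add2)
    next
      case False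
      then have "1 \<le> b" "(cls x, cls y) \<in> parcs H" using braid_step braid by blast+
      then show ?thesis
        using p by (intro exI[of _ "(cls x, cls y) # p"]) (auto simp: awalk_Cons_iff)
    qed
  qed
  have dist: "\<mu> (\<lambda>_. 1) (cls x) (cls y) = word_dist a b x y" if "x \<in> V" "y \<in> V" for x y
  proof (rule antisym)
    show "\<mu> (\<lambda>_. 1) (cls x) (cls y) \<le> word_dist a b x y"
      unfolding word_dist_def
    proof (rule INF_greatest)
      fix c assume "c \<in> {c. connects a b x y c}"
      then obtain p where p: "awalk (cls x) p (cls y)" "length p \<le> c"
        using connects_walk \<open>x \<in> V\<close> by blast
      show "\<mu> (\<lambda>_. 1) (cls x) (cls y) \<le> ereal (real c)"
        unfolding \<mu>_def by (rule INF_lower2[of p]) (use p cost in auto)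
    qed
    show "word_dist a b x y \<le> \<mu> (\<lambda>_. 1) (cls x) (cls y)"
      unfolding \<mu>_def
    proof (rule INF_greatest)
      fix p assume "p \<in> {p. awalk (cls x) p (cls y)}"
      then show "word_dist a b x y \<le> ereal (awalk_cost (\<lambda>_. 1) p)"
        using walk_connects that word_dist_le cost by auto
    qed
  qed
  have "pverts H \<times> pverts H = (\<lambda>(x, y). (cls x, cls y)) ` (V \<times> V)"
    unfolding verts by auto
  then have "(\<lambda>(u, v). \<mu> (\<lambda>_. 1) u v) ` (pverts H \<times> pverts H) =
      (\<lambda>(x, y). word_dist a b x y) ` (V \<times> V)"
    using dist by (auto simp: image_image intro!: image_cong)
  then show ?thesis
    unfolding diameter_of_def word_diam_def by simp
qed

section \<open>The permutation of a word and its invariance under moves\<close>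

definition word_perm :: "nat list \<Rightarrow> nat \<Rightarrow> nat" where
  "word_perm w = foldr (\<circ>) (map (\<lambda>r. transpose r (r + 1)) w) id"

lemma word_perm_Nil [simp]: "word_perm [] = id"
  by (simp add: word_perm_def)

lemma word_perm_Cons: "word_perm (r # w) = transpose r (r + 1) \<circ> word_perm w"
  by (simp add: word_perm_def)

lemma word_perm_append: "word_perm (u @ v) = word_perm u \<circ> word_perm v"
  by (induction u) (simp_all add: word_perm_Cons o_assoc)

lemma reduced_words_iff:
  "w \<in> reduced_words n p \<longleftrightarrow>
    set w \<subseteq> {1..<n} \<and> length w = inversion_number n p \<and> word_perm w = p"
  by (auto simp: reduced_words_def word_perm_def)

lemma transpose_commute:
  "\<bar>int j - int k\<bar> > 1 \<Longrightarrow>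
    transpose j (j + 1) \<circ> transpose k (k + 1) = transpose k (k + 1) \<circ> transpose j (j + 1)"
  by (auto simp: fun_eq_iff transpose_def)

lemma transpose_braid:
  "transpose j (j + 1) \<circ> transpose (j + 1) (j + 1 + 1) \<circ> transpose j (j + 1) =
    transpose (j + 1) (j + 1 + 1) \<circ> transpose j (j + 1) \<circ> transpose (j + 1) (j + 1 + 1)" for j :: nat
  by (auto simp: fun_eq_iff transpose_def)

lemma move_invariants:
  assumes "(x, y) \<in> commutation_moves \<union> braid_moves"
  shows "set y = set x \<and> length y = length x \<and> word_perm y = word_perm x"
  using assms
proof
  assume "(x, y) \<in> commutation_moves"
  then show ?thesis
  proof (cases rule: commutation_movesE)
    case (1 u v j k)
    have "word_perm [j, k] = word_perm [k, j]"
      using transpose_commute[OF 1(3)] by (simp add: word_perm_Cons)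
    then have "word_perm x = word_perm y"
      unfolding 1 word_perm_append by simp
    then show ?thesis by (auto simp: 1(1,2))
  qed
next
  assume "(x, y) \<in> braid_moves"
  then show ?thesis
  proof (cases rule: braid_movesE)
    case (1 u v j)
    have "word_perm [j, j + 1, j] = word_perm [j + 1, j, j + 1]"
      using transpose_braid[of j] by (simp add: word_perm_Cons o_assoc)
    then have "word_perm x = word_perm y"
      unfolding 1 word_perm_append by simp
    then show ?thesis by (auto simp: 1)
  next
    case (2 u v j)
    have "word_perm [j, j + 1, j] = word_perm [j + 1, j, j + 1]"
      using transpose_braid[of j] by (simp add: word_perm_Cons o_assoc)
    then have "word_perm x = word_perm y"
      unfolding 2 word_perm_append by simp
    then show ?thesis by (auto simp: 2)
  qed
qed

lemma connects_word_perm: "connects a b x y c \<Longrightarrow> word_perm y = word_perm x"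
  by (induction rule: connects.induct) (use move_invariants in auto)

lemma reduced_words_move:
  assumes "x \<in> reduced_words n p" "(x, y) \<in> commutation_moves \<union> braid_moves"
  shows "y \<in> reduced_words n p"
  using move_invariants[OF assms(2)] assms(1) by (simp add: reduced_words_iff)

section \<open>The three graph diameters as weighted diameters\<close>

lemma diameter_of_word_graph:
  "diameter_of (word_graph n p) = word_diam 1 1 (reduced_words n p)"
proof (rule diameter_of_eq_word_diam[where cls = "\<lambda>x. x"])
  show "pair_wf_digraph (word_graph n p)"
    by standard (auto simp: word_graph_def)
  show "x \<in> reduced_words n p \<Longrightarrow> (x, y) \<in> commutation_moves \<union> braid_moves \<Longrightarrow>
    y \<in> reduced_words n p" for x y
    by (rule reduced_words_move)
  show "\<exists>x\<in>reduced_words n p. \<exists>y\<in>reduced_words n p. X = x \<and> Y = y \<and> connects 1 1 x y 1"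
    if "(X, Y) \<in> parcs (word_graph n p)" for X Y
    using that connects_comm[of X Y 1 1] connects_braid[of X Y 1 1] by (auto simp: word_graph_def)
qed (auto simp: word_graph_def intro: reduced_words_move connects.refl)

text \<open>Each vertex is a class joined by free moves, so counting edges in the contraction and
  paying for moves in the word graph agree. The disjunctions \<open>comm\<close> and
  \<open>braid\<close> let a cost vanish only when that whole kind of move is contracted.\<close>

lemma diameter_of_contract_edges:
  assumes F: "sym F"
    and zero: "\<And>x y. (x, y) \<in> F \<Longrightarrow> connects a b x y 0"
    and one: "\<And>x y. (x, y) \<in> commutation_moves \<union> braid_moves \<Longrightarrow> (x, y) \<notin> F \<Longrightarrow> connects a b x y 1"
    and comm: "commutation_moves \<subseteq> F \<or> 1 \<le> a"
    and braid: "braid_moves \<subseteq> F \<or> 1 \<le> b"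
  shows "diameter_of (contract_edges (word_graph n p) F) = word_diam a b (reduced_words n p)"
proof -
  let ?G = "word_graph n p" and ?V = "reduced_words n p"
  let ?r = "contraction_rel ?G F"
  define cls where "cls x = ?r `` {x}" for x
  have eqv: "equiv ?V ?r"
    using equiv_contraction_rel[OF pair_graph_word_graph F] by (simp add: word_graph_def)
  have quot: "pverts (contract_edges ?G F) = cls ` ?V"
    by (auto simp: contract_edges_def cls_def quotient_def word_graph_def)
  have rel: "connects a b x y 0" if "(x, y) \<in> ?r" for x y
  proof -
    have "(x, y) \<in> (parcs ?G \<inter> F)\<^sup>*"
      using that by (simp add: contraction_rel_def)
    then show ?thesis
    proof (induction rule: rtrancl_induct)
      case (step y z)
      then show ?case using zero[of y z] connects_trans[of a b x y 0 z 0] by auto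
    qed (rule connects.refl)
  qed
  have cls_eq: "cls x = cls y \<longleftrightarrow> (x, y) \<in> ?r" if "x \<in> ?V" "y \<in> ?V" for x y
    using eq_equiv_class_iff[OF eqv] that unfolding cls_def by auto
  have move: "cls x = cls y \<or> (x, y) \<notin> F \<and> (cls x, cls y) \<in> parcs (contract_edges ?G F)"
    if "x \<in> ?V" "(x, y) \<in> commutation_moves \<union> braid_moves" for x y
  proof -
    have y: "y \<in> ?V" using that by (rule reduced_words_move)
    have xy: "(x, y) \<in> parcs ?G" using that y by (simp add: word_graph_def)
    have "x \<in> cls x" "y \<in> cls y"
      using equiv_class_self[OF eqv] that(1) y unfolding cls_def by blast+
    moreover have "cls x = cls y" if "(x, y) \<in> F"
      using xy \<open>x \<in> ?V\<close> y that cls_eq by (auto simp: contraction_rel_def word_graph_def)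
    moreover have "cls x \<in> cls ` ?V" "cls y \<in> cls ` ?V"
      using that(1) y by auto
    ultimately show ?thesis
      using xy quot by (auto simp: contract_edges_def)
  qed
  show ?thesis
  proof (rule diameter_of_eq_word_diam[where cls = cls])
    show "pair_wf_digraph (contract_edges ?G F)"
      by standard (auto simp: contract_edges_def)
    show "pverts (contract_edges ?G F) = cls ` ?V" by (rule quot)
    show "x \<in> ?V \<Longrightarrow> (x, y) \<in> commutation_moves \<union> braid_moves \<Longrightarrow> y \<in> ?V" for x y
      by (rule reduced_words_move)
    show "x \<in> ?V \<Longrightarrow> y \<in> ?V \<Longrightarrow> cls x = cls y \<Longrightarrow> connects a b x y 0" for x y
      using rel cls_eq by blast
    show "\<exists>x\<in>?V. \<exists>y\<in>?V. X = cls x \<and> Y = cls y \<and> connects a b x y 1"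
      if XY: "(X, Y) \<in> parcs (contract_edges ?G F)" for X Y
    proof -
      obtain x y where *: "x \<in> X" "y \<in> Y" "(x, y) \<in> parcs ?G" "X \<noteq> Y"
        "X \<in> ?V // ?r" "Y \<in> ?V // ?r"
        using XY by (auto simp: contract_edges_def word_graph_def)
      then have xy: "x \<in> ?V" "y \<in> ?V" "(x, y) \<in> commutation_moves \<union> braid_moves"
        by (auto simp: word_graph_def)
      have X: "X = cls x" and Y: "Y = cls y"
        using * eqv unfolding cls_def by (auto simp: quotient_def equiv_class_eq_iff)
      \<comment> \<open>A contracted move would put both words into one class, but \<open>X\<close>
        and \<open>Y\<close> differ.\<close>
      then have "(x, y) \<notin> F"
        using * xy cls_eq by (auto simp: contraction_rel_def)
      then show ?thesis
        using X Y xy one by blast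
    qed
    show "cls x = cls y \<or> 1 \<le> a \<and> (cls x, cls y) \<in> parcs (contract_edges ?G F)"
      if "x \<in> ?V" "(x, y) \<in> commutation_moves" for x y
      using move[of x y] comm that by blast
    show "cls x = cls y \<or> 1 \<le> b \<and> (cls x, cls y) \<in> parcs (contract_edges ?G F)"
      if "x \<in> ?V" "(x, y) \<in> braid_moves" for x y
      using move[of x y] braid that by blast
  qed
qed

lemma diameter_of_commutation_contracted_graph:
  "diameter_of (commutation_contracted_graph n p) = word_diam 0 1 (reduced_words n p)"
  unfolding commutation_contracted_graph_def
  by (rule diameter_of_contract_edges[OF sym_commutation_moves])
    (auto intro: connects_comm connects_braid)

lemma diameter_of_braid_contracted_graph:
  "diameter_of (braid_contracted_graph n p) = word_diam 1 0 (reduced_words n p)"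
  unfolding braid_contracted_graph_def
  by (rule diameter_of_contract_edges[OF sym_braid_moves])
    (auto intro: connects_comm connects_braid)

section \<open>Products of word graphs\<close>

text \<open>
  \<open>I u v\<close> and \<open>J u v\<close> are the two extreme elements of \<open>V\<close> with projections \<open>u\<close> and \<open>v\<close>, and \<open>h\<close> is the
  cost of passing to \<open>J\<close>. Routes through \<open>I\<close> and through \<open>J\<close> together cost \<open>2 K\<close> more than twice the
  distance of the projections, so the cheaper one gives the upper bound.
\<close>

lemma word_diam_product:
  assumes fin: "finite V1" "V1 \<noteq> {}" "finite V2" "V2 \<noteq> {}"
    and closed: "\<And>x y. x \<in> V \<Longrightarrow> (x, y) \<in> commutation_moves \<union> braid_moves \<Longrightarrow> y \<in> V"
    and f: "\<And>x. x \<in> V \<Longrightarrow> f x \<in> V1" and g: "\<And>x. x \<in> V \<Longrightarrow> g x \<in> V2"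
    and I: "\<And>u v. u \<in> V1 \<Longrightarrow> v \<in> V2 \<Longrightarrow>
      I u v \<in> V \<and> f (I u v) = u \<and> g (I u v) = v \<and> h (I u v) = K"
    and J: "\<And>u v. u \<in> V1 \<Longrightarrow> v \<in> V2 \<Longrightarrow>
      J u v \<in> V \<and> f (J u v) = u \<and> g (J u v) = v \<and> h (J u v) = 0"
    and I_hom: "\<And>u v u' v' c d. connects a b u u' c \<Longrightarrow> connects a b v v' d \<Longrightarrow>
      connects a b (I u v) (I u' v') (c + d)"
    and J_hom: "\<And>u v u' v' c d. connects a b u u' c \<Longrightarrow> connects a b v v' d \<Longrightarrow>
      connects a b (J u v) (J u' v') (c + d)"
    and route: "\<And>x. x \<in> V \<Longrightarrow> \<exists>c d. c + d = K \<and>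
      connects a b x (I (f x) (g x)) c \<and> connects a b x (J (f x) (g x)) d"
    and comm_step: "\<And>x y. x \<in> V \<Longrightarrow> (x, y) \<in> commutation_moves \<Longrightarrow>
      \<exists>c d. connects a b (f x) (f y) c \<and> connects a b (g x) (g y) d \<and> h x + c + d \<le> h y + a"
    and braid_step: "\<And>x y. x \<in> V \<Longrightarrow> (x, y) \<in> braid_moves \<Longrightarrow>
      \<exists>c d. connects a b (f x) (f y) c \<and> connects a b (g x) (g y) d \<and> h x + c + d \<le> h y + b"
  shows "word_diam a b V = word_diam a b V1 + word_diam a b V2 + ereal (real K)"
proof (rule antisym)
  \<comment> \<open>The one-move inequality telescopes: the cost of a path pays for paths between
    both projections and for the loss of potential.\<close>
  have project: "\<exists>c d. connects a b (f x) (f y) c \<and> connects a b (g x) (g y) d \<and> h x + c + d \<le> h y + e"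
    if "connects a b x y e" "x \<in> V" for x y e
    using that
  proof (induction rule: connects.induct)
    case (refl x)
    then show ?case using connects.refl[of a b] by fastforce
  next
    case (comm x y z e)
    then have "y \<in> V" using closed by blast
    with comm.IH obtain c d where 1: "connects a b (f y) (f z) c" "connects a b (g y) (g z) d"
      "h y + c + d \<le> h z + e" by blast
    obtain c' d' where 2: "connects a b (f x) (f y) c'" "connects a b (g x) (g y) d'"
      "h x + c' + d' \<le> h y + a" using comm_step[OF comm.prems comm.hyps(1)] by blast
    show ?case
      using connects_trans[OF 2(1) 1(1)] connects_trans[OF 2(2) 1(2)] 1(3) 2(3)
      by (intro exI[of _ "c' + c"] exI[of _ "d' + d"]) auto
  next
    case (braid x y z e)
    then have "y \<in> V" using closed by blast
    with braid.IH obtain c d where 1: "connects a b (f y) (f z) c" "connects a b (g y) (g z) d"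
      "h y + c + d \<le> h z + e" by blast
    obtain c' d' where 2: "connects a b (f x) (f y) c'" "connects a b (g x) (g y) d'"
      "h x + c' + d' \<le> h y + b" using braid_step[OF braid.prems braid.hyps(1)] by blast
    show ?case
      using connects_trans[OF 2(1) 1(1)] connects_trans[OF 2(2) 1(2)] 1(3) 2(3)
      by (intro exI[of _ "c' + c"] exI[of _ "d' + d"]) auto
  qed
  show "word_diam a b V1 + word_diam a b V2 + ereal (real K) \<le> word_diam a b V"
  proof -
    obtain u u' where u: "u \<in> V1" "u' \<in> V1" "word_diam a b V1 = word_dist a b u u'"
      using word_diam_attained fin(1,2) by blast
    obtain v v' where v: "v \<in> V2" "v' \<in> V2" "word_diam a b V2 = word_dist a b v v'"
      using word_diam_attained fin(3,4) by blast
    \<comment> \<open>The endpoints are chosen crosswise, \<open>I\<close> over one end of the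
      extremal pairs and \<open>J\<close> over the other, so that the full potential
      \<open>K\<close> is lost on top of the projected distances.\<close>
    have "word_dist a b u u' + word_dist a b v v' + ereal (real K) \<le> word_dist a b (I u v) (J u' v')"
      unfolding word_dist_def[of a b "I u v"]
    proof (rule INF_greatest)
      fix e assume "e \<in> {e. connects a b (I u v) (J u' v') e}"
      then obtain c d where cd: "connects a b u u' c" "connects a b v v' d" "K + c + d \<le> e"
        using project[of "I u v" "J u' v'" e] I[OF u(1) v(1)] J[OF u(2) v(2)] by auto
      have "word_dist a b u u' + word_dist a b v v' + ereal (real K) \<le>
          ereal (real c) + ereal (real d) + ereal (real K)"
        using cd(1,2)[THEN word_dist_le] by (intro add_mono order.refl)
      also have "\<dots> \<le> ereal (real e)"
        using cd(3) by simp
      finally show "word_dist a b u u' + word_dist a b v v' + ereal (real K) \<le> ereal (real e)" .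
    qed
    also have "\<dots> \<le> word_diam a b V"
      using I[OF u(1) v(1)] J[OF u(2) v(2)] by (intro word_dist_le_diam) auto
    finally show ?thesis by (simp add: u v)
  qed
  have "word_dist a b x y \<le> word_diam a b V1 + word_diam a b V2 + ereal (real K)"
    if xy: "x \<in> V" "y \<in> V" for x y
  proof -
    have "word_dist a b x y \<le> word_dist a b (f x) (f y) + word_dist a b (g x) (g y) + ereal (real K)"
    proof (cases rule: word_dist_cases[of a b "f x" "f y"])
      case (1 c)
      note c = this
      show ?thesis
      proof (cases rule: word_dist_cases[of a b "g x" "g y"])
        case (1 d)
        obtain r s where rs: "r + s = K" "connects a b x (I (f x) (g x)) r"
          "connects a b x (J (f x) (g x)) s"
          using route xy(1) by blast
        obtain r' s' where rs': "r' + s' = K" "connects a b y (I (f y) (g y)) r'"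
          "connects a b y (J (f y) (g y)) s'"
          using route xy(2) by blast
        have "connects a b x y (r + (c + d) + r')"
          using rs(2) I_hom[OF c(1) 1(1)] connects_sym[OF rs'(2)] by (blast intro: connects_trans)
        moreover have "connects a b x y (s + (c + d) + s')"
          using rs(3) J_hom[OF c(1) 1(1)] connects_sym[OF rs'(3)] by (blast intro: connects_trans)
        moreover have "r + (c + d) + r' \<le> c + d + K \<or> s + (c + d) + s' \<le> c + d + K"
          using rs(1) rs'(1) by linarith
        ultimately obtain e where "connects a b x y e" "e \<le> c + d + K"
          by blast
        then have "word_dist a b x y \<le> ereal (real (c + d + K))"
          by (meson word_dist_le ereal_less_eq(3) of_nat_le_iff order_trans)
        then show ?thesis by (simp add: c(2) 1(2))
      next
        case 2
        then show ?thesis using c by simp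
      qed
    next
      case 2
      \<comment> \<open>The bound is trivial here: the other distance is nonnegative, so the sum is
        \<infinity>.\<close>
      then show ?thesis using word_dist_nonneg[of a b "g x" "g y"] by auto
    qed
    also have "\<dots> \<le> word_diam a b V1 + word_diam a b V2 + ereal (real K)"
      using xy f g by (intro add_mono order.refl word_dist_le_diam) auto
    finally show ?thesis .
  qed
  then show "word_diam a b V \<le> word_diam a b V1 + word_diam a b V2 + ereal (real K)"
    unfolding word_diam_def[of a b V] by (auto intro: SUP_least)
qed

section \<open>Inversions and word length\<close>

lemma word_perm_permutes: "set w \<subseteq> {1..<n} \<Longrightarrow> word_perm w permutes {1..n}"
  by (induction w)
    (auto simp: word_perm_Cons permutes_id intro!: permutes_compose permutes_swap_id)

text \<open>Multiplication on the left exchanges the consecutive values r and r + 1. Their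
  comparison with any other value is unchanged, so the pair of positions holding them is the only
  new inversion.\<close>

lemma inversion_number_transpose:
  assumes p: "p permutes {1..n}" and r: "r \<in> {1..<n}" and less: "inv p r < inv p (r + 1)"
  shows "inversion_number n (transpose r (r + 1) \<circ> p) = Suc (inversion_number n p)"
proof -
  let ?i = "inv p r" and ?j = "inv p (r + 1)" and ?q = "transpose r (r + 1) \<circ> p"
  let ?S = "{(i, j). i \<in> {1..n} \<and> j \<in> {1..n} \<and> i < j \<and> p j < p i}"
  have val: "p ?i = r" "p ?j = r + 1"
    using permutes_inverses(1)[OF p] by auto
  have mem: "?i \<in> {1..n}" "?j \<in> {1..n}"
    using r permutes_in_image[OF permutes_inv[OF p]] by auto
  have eq: "p i = p j \<longleftrightarrow> i = j" for i j
    using permutes_inj[OF p] by (auto dest: injD)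
  have idx: "p i = r \<longleftrightarrow> i = ?i" "p i = r + 1 \<longleftrightarrow> i = ?j" for i
    using val eq by metis+
  have cmp: "?q j < ?q i \<longleftrightarrow> (i = ?i \<and> j = ?j) \<or> p j < p i \<and> \<not> (i = ?j \<and> j = ?i)" for i j
    using idx[of i] idx[of j] val less by (auto simp: transpose_def)
  have "{(i, j). i \<in> {1..n} \<and> j \<in> {1..n} \<and> i < j \<and> ?q j < ?q i} = insert (?i, ?j) ?S"
    unfolding cmp using mem less by auto
  moreover have "(?i, ?j) \<notin> ?S"
    using val by auto
  moreover have "finite ?S"
    by (rule finite_subset[of _ "{1..n} \<times> {1..n}"]) auto
  ultimately show ?thesis
    unfolding inversion_number_def by simp
qed

lemma inv_transpose_comp:
  fixes p :: "nat \<Rightarrow> nat"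
  assumes "p permutes {1..n}"
  shows "inv (transpose r (r + 1) \<circ> p) = inv p \<circ> transpose r (r + 1)"
  using assms by (simp add: o_inv_distrib permutes_bij)

lemma inversion_number_transpose':
  assumes p: "p permutes {1..n}" and r: "r \<in> {1..<n}" and less: "inv p (r + 1) < inv p r"
  shows "Suc (inversion_number n (transpose r (r + 1) \<circ> p)) = inversion_number n p"
proof -
  let ?q = "transpose r (r + 1) \<circ> p"
  have "?q permutes {1..n}"
    using p r by (intro permutes_compose permutes_swap_id) auto
  moreover have "inv ?q r < inv ?q (r + 1)"
    using less unfolding inv_transpose_comp[OF p] by simp
  moreover have "transpose r (r + 1) \<circ> ?q = p"
    by (simp add: o_assoc)
  ultimately show ?thesis
    using inversion_number_transpose[of ?q n r] r by simp
qed

lemma inv_neq: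
  fixes p :: "nat \<Rightarrow> nat"
  assumes "p permutes {1..n}"
  shows "inv p r \<noteq> inv p (r + 1)"
  using permutes_inj[OF permutes_inv[OF assms]] by (simp add: inj_eq)

lemma inversion_number_transpose_le:
  assumes "p permutes {1..n}" "r \<in> {1..<n}"
  shows "inversion_number n (transpose r (r + 1) \<circ> p) \<le> Suc (inversion_number n p)"
  using inversion_number_transpose[OF assms] inversion_number_transpose'[OF assms]
    inv_neq[OF assms(1), of r] by linarith

lemma inversion_number_id: "inversion_number n id = 0"
  by (auto simp: inversion_number_def card_eq_0_iff)

lemma inversion_number_word_perm: "set w \<subseteq> {1..<n} \<Longrightarrow> inversion_number n (word_perm w) \<le> length w"
proof (induction w)
  case (Cons r w)
  then have "set w \<subseteq> {1..<n}" "r \<in> {1..<n}" by auto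
  with Cons.IH inversion_number_transpose_le[OF word_perm_permutes, of w n r]
  show ?case
    unfolding word_perm_Cons list.size by linarith
qed (simp add: inversion_number_id)

text \<open>Otherwise \<open>inv p\<close> increases along \<open>{1..n}\<close> and hence lies
  above the identity there, which for a permutation of this interval forces equality.\<close>

lemma exists_inverse_descent:
  fixes p :: "nat \<Rightarrow> nat"
  assumes p: "p permutes {1..n}" and "p \<noteq> id"
  obtains r where "r \<in> {1..<n}" "inv p (r + 1) < inv p r"
proof (rule ccontr)
  note descent = that
  assume *: "\<not> thesis"
  have inc: "inv p r < inv p (r + 1)" if "r \<in> {1..<n}" for r
    using inv_neq[OF p, of r] that descent[of r] * by (metis linorder_neqE_nat)
  have q: "inv p permutes {1..n}" by (rule permutes_inv[OF p])
  have "i \<in> {1..n} \<Longrightarrow> i \<le> inv p i" for i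
  proof (induction i)
    case (Suc i)
    then show ?case
      using inc[of i] permutes_in_image[OF q, of "Suc i"] by (cases "i = 0") auto
  qed simp
  then have "inv p = id" using permutes_natset_ge[OF q] by blast
  then show False
    using \<open>p \<noteq> id\<close> p by (metis inv_id permutes_inv_inv)
qed

lemma reduced_words_nonempty: "p permutes {1..n} \<Longrightarrow> reduced_words n p \<noteq> {}"
proof (induction "inversion_number n p" arbitrary: p rule: less_induct)
  case less
  show ?case
  proof (cases "p = id")
    case True
    then have "[] \<in> reduced_words n p" by (simp add: reduced_words_iff inversion_number_id)
    then show ?thesis by blast
  next
    case False
    then obtain r where r: "r \<in> {1..<n}" "inv p (r + 1) < inv p r"
      using exists_inverse_descent less.prems by blast
    let ?q = "transpose r (r + 1) \<circ> p"
    have q: "?q permutes {1..n}"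
      using less.prems r by (intro permutes_compose permutes_swap_id) auto
    have len: "Suc (inversion_number n ?q) = inversion_number n p"
      by (rule inversion_number_transpose'[OF less.prems r])
    then obtain w where w: "w \<in> reduced_words n ?q"
      using less.hyps[of ?q] q by auto
    have "p = transpose r (r + 1) \<circ> ?q"
      by (simp add: o_assoc)
    then have "p = transpose r (r + 1) \<circ> word_perm w"
      using w by (simp add: reduced_words_iff)
    then have "r # w \<in> reduced_words n p"
      using w r len by (auto simp: reduced_words_iff word_perm_Cons)
    then show ?thesis by blast
  qed
qed

text \<open>One inequality suffices, because a word is never shorter than the number of inversions
  it creates. This turns the length counts below into reducedness.\<close>

lemma reduced_wordsI:
  assumes "set w \<subseteq> {1..<n}" "word_perm w = p" "length w \<le> inversion_number n p"
  shows "w \<in> reduced_words n p"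
  using inversion_number_word_perm[OF assms(1)] assms by (simp add: reduced_words_iff)

lemma reduced_wordsD:
  assumes "w \<in> reduced_words n p"
  shows "set w \<subseteq> {1..<n}" "length w = inversion_number n p" "word_perm w = p"
  using assms by (simp_all add: reduced_words_iff)

text \<open>If r stood to the left of r + 1 in \<open>p\<close>, the tail would represent a
  permutation with more inversions than the tail has letters.\<close>

lemma reduced_words_ConsD:
  assumes "r # w \<in> reduced_words n p" "p permutes {1..n}"
  shows "inv p (r + 1) < inv p r" "w \<in> reduced_words n (transpose r (r + 1) \<circ> p)"
proof -
  let ?q = "transpose r (r + 1) \<circ> p"
  have r: "r \<in> {1..<n}" and w: "set w \<subseteq> {1..<n}" and len: "Suc (length w) = inversion_number n p"
    and p: "p = transpose r (r + 1) \<circ> word_perm w"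
    using assms(1) by (auto simp: reduced_words_iff word_perm_Cons)
  have q: "word_perm w = ?q"
    by (simp add: p o_assoc)
  have le: "inversion_number n ?q \<le> length w"
    using inversion_number_word_perm[OF w] unfolding q .
  then show less: "inv p (r + 1) < inv p r"
    using inversion_number_transpose[OF assms(2) r] inv_neq[OF assms(2), of r] len by linarith
  show "w \<in> reduced_words n ?q"
    using inversion_number_transpose'[OF assms(2) r less] len
    by (intro reduced_wordsI w q) linarith
qed

lemma connects_letter_right:
  "(\<And>s. s \<in> set v \<Longrightarrow> \<bar>int r - int s\<bar> > 1) \<Longrightarrow> connects a b (r # v) (v @ [r]) (a * length v)"
proof (induction v)
  case Nil
  then show ?case by (simp add: connects.refl)
next
  case (Cons s v)
  have "(r # s # v, s # r # v) \<in> commutation_moves"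
    using commutation_movesI[of r s "[]" v] Cons.prems[of s] by simp
  moreover have "connects a b (s # r # v) (s # v @ [r]) (a * length v)"
    using Cons by (intro connects_Cons) auto
  ultimately have "connects a b (r # s # v) (s # v @ [r]) (a + a * length v)"
    by (rule connects.comm)
  then show ?case by simp
qed

section \<open>Direct sums\<close>

abbreviation low_part :: "nat \<Rightarrow> nat list \<Rightarrow> nat list" where
  "low_part k w \<equiv> filter (\<lambda>r. r < k) w"

abbreviation high_part :: "nat \<Rightarrow> nat list \<Rightarrow> nat list" where
  "high_part k w \<equiv> map (\<lambda>r. r - k) (filter (\<lambda>r. k < r) w)"

text \<open>A first letter k would need k + 1 to stand to the left of k, but \<open>p\<close> keeps
  the values up to k on the positions up to k. Any other first letter respects this block structure,
  so the induction goes on.\<close>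

lemma not_in_reduced_word:
  assumes "w \<in> reduced_words n p" "p permutes {1..n}" "\<And>i. p i \<le> k \<longleftrightarrow> i \<le> k"
  shows "k \<notin> set w"
  using assms
proof (induction w arbitrary: p)
  case (Cons r w)
  let ?q = "transpose r (r + 1) \<circ> p"
  have *: "p (inv p r) = r" "p (inv p (r + 1)) = r + 1"
    using permutes_inverses(1)[OF Cons.prems(2)] by auto
  have "r \<noteq> k"
    using reduced_words_ConsD(1)[OF Cons.prems(1,2)]
      Cons.prems(3)[of "inv p r"] Cons.prems(3)[of "inv p (r + 1)"] * by auto
  have "r \<in> {1..<n}" using Cons.prems(1) by (auto simp: reduced_words_iff word_perm_Cons)
  have "k \<notin> set w"
  proof (rule Cons.IH)
    show "w \<in> reduced_words n ?q"
      by (rule reduced_words_ConsD(2)[OF Cons.prems(1,2)])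
    show "?q permutes {1..n}"
      using Cons.prems(2) \<open>r \<in> {1..<n}\<close> by (intro permutes_compose permutes_swap_id) auto
    show "?q i \<le> k \<longleftrightarrow> i \<le> k" for i
      using Cons.prems(3)[of i] \<open>r \<noteq> k\<close> by (auto simp: transpose_def)
  qed
  with \<open>r \<noteq> k\<close> show ?case by simp
qed simp

lemma inflate_12_le_iff:
  assumes "p permutes {1..a}" "q permutes {1..b}"
  shows "inflate_12 a p b q i \<le> a \<longleftrightarrow> i \<le> a"
  using permutes_in_image[OF assms(1), of i] permutes_in_image[OF assms(2), of "i - a"]
  by (cases "i = 0") (auto simp: inflate_12_def)

lemma transpose_inflate_12_low:
  assumes "q permutes {1..b}" "1 \<le> r" "r < a"
  shows "transpose r (r + 1) \<circ> inflate_12 a p b q = inflate_12 a (transpose r (r + 1) \<circ> p) b q"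
proof
  fix i
  show "(transpose r (r + 1) \<circ> inflate_12 a p b q) i =
      inflate_12 a (transpose r (r + 1) \<circ> p) b q i"
  proof (cases "i \<in> {a + 1..a + b}")
    case True
    then have "1 \<le> q (i - a)"
      using permutes_in_image[OF assms(1), of "i - a"] by auto
    then show ?thesis
      using True assms(2,3) by (simp add: inflate_12_def)
  next
    case False
    then show ?thesis
      using assms(2,3) by (auto simp: inflate_12_def transpose_apply_other)
  qed
qed

lemma transpose_inflate_12_high:
  assumes "p permutes {1..a}" "a < r" "r < a + b"
  shows "transpose r (r + 1) \<circ> inflate_12 a p b q =
    inflate_12 a p b (transpose (r - a) (r - a + 1) \<circ> q)"
proof
  fix i
  have shift: "transpose r (r + 1) (x + a) = transpose (r - a) (r - a + 1) x + a" for x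
    using assms(2) by (auto simp: transpose_def)
  show "(transpose r (r + 1) \<circ> inflate_12 a p b q) i =
      inflate_12 a p b (transpose (r - a) (r - a + 1) \<circ> q) i"
  proof (cases "i \<in> {1..a}")
    case True
    then have "p i \<le> a"
      using permutes_in_image[OF assms(1), of i] by auto
    then show ?thesis
      using True assms(2,3) by (simp add: inflate_12_def transpose_apply_other)
  next
    case False
    then show ?thesis
      using assms(2,3) shift by (auto simp: inflate_12_def transpose_apply_other)
  qed
qed

lemma inflate_12_inject:
  assumes eq: "inflate_12 a p b q = inflate_12 a p' b q'"
    and "p permutes {1..a}" "q permutes {1..b}" "p' permutes {1..a}" "q' permutes {1..b}"
  shows "p = p'" "q = q'"
proof -
  show "p = p'"
  proof
    fix i
    show "p i = p' i"
      using fun_cong[OF eq, of i] assms(2,4)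
      by (cases "i \<in> {1..a}") (auto simp: inflate_12_def permutes_not_in)
  qed
  show "q = q'"
  proof
    fix i
    show "q i = q' i"
      using fun_cong[OF eq, of "i + a"] assms(3,5)
      by (cases "i \<in> {1..b}") (auto simp: inflate_12_def permutes_not_in)
  qed
qed

lemma parts_letters:
  assumes "set w \<subseteq> {1..<a + b}"
  shows "set (low_part a w) \<subseteq> {1..<a}" "set (high_part a w) \<subseteq> {1..<b}"
  using assms by fastforce+

lemma length_parts: "a \<notin> set w \<Longrightarrow> length (low_part a w) + length (high_part a w) = length w"
  by (induction w) auto

lemma word_perm_parts:
  assumes "set w \<subseteq> {1..<a + b}" "a \<notin> set w"
  shows "word_perm w = inflate_12 a (word_perm (low_part a w)) b (word_perm (high_part a w))"
  using assms
proof (induction w)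
  case Nil
  show ?case by (auto simp: inflate_12_def)
next
  case (Cons r w)
  then have w: "set w \<subseteq> {1..<a + b}" "a \<notin> set w" and r: "r \<noteq> a" "1 \<le> r" "r < a + b" by auto
  note IH = Cons.IH[OF w]
  have perms: "word_perm (low_part a w) permutes {1..a}" "word_perm (high_part a w) permutes {1..b}"
    using parts_letters[OF w(1)] by (blast intro: word_perm_permutes)+
  show ?case
  proof (cases "r < a")
    case True
    then have "low_part a (r # w) = r # low_part a w" "high_part a (r # w) = high_part a w"
      by auto
    then show ?thesis
      unfolding word_perm_Cons IH
      using transpose_inflate_12_low[OF perms(2) r(2) True] by (simp only: word_perm_Cons)
  next
    case False
    then have "low_part a (r # w) = low_part a w" "high_part a (r # w) = (r - a) # high_part a w"
      using r by auto
    then show ?thesis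
      unfolding word_perm_Cons IH
      using transpose_inflate_12_high[OF perms(1), of r b] r False by (simp only: word_perm_Cons)
  qed
qed

lemma parts_concat:
  assumes "set u \<subseteq> {1..<a}" "set v \<subseteq> {1..<b}"
  shows "low_part a (u @ map (\<lambda>r. r + a) v) = u" "high_part a (u @ map (\<lambda>r. r + a) v) = v"
    "low_part a (map (\<lambda>r. r + a) v @ u) = u" "high_part a (map (\<lambda>r. r + a) v @ u) = v"
    "set (u @ map (\<lambda>r. r + a) v) \<subseteq> {1..<a + b}" "a \<notin> set (u @ map (\<lambda>r. r + a) v)"
proof -
  have *: "low_part a u = u" "high_part a u = []"
    "low_part a (map (\<lambda>r. r + a) v) = []" "high_part a (map (\<lambda>r. r + a) v) = v"
    using assms by (auto simp: filter_id_conv filter_empty_conv filter_map comp_def subset_iff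
        intro!: map_idI)
  show "low_part a (u @ map (\<lambda>r. r + a) v) = u" "high_part a (u @ map (\<lambda>r. r + a) v) = v"
    "low_part a (map (\<lambda>r. r + a) v @ u) = u" "high_part a (map (\<lambda>r. r + a) v @ u) = v"
    unfolding filter_append map_append * by simp_all
  show "set (u @ map (\<lambda>r. r + a) v) \<subseteq> {1..<a + b}" "a \<notin> set (u @ map (\<lambda>r. r + a) v)"
    using assms by (auto simp: subset_iff)
qed

context
  fixes a b :: nat and p q :: "nat \<Rightarrow> nat"
  assumes p: "p permutes {1..a}" and q: "q permutes {1..b}"
begin

text \<open>Read off from a word: a word for \<open>p\<close> followed by a shifted word for
  \<open>q\<close> represents the sum, and words in these letters represent permutations.\<close>

lemma inflate_12_permutes: "inflate_12 a p b q permutes {1..a + b}"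
proof -
  obtain u v where "u \<in> reduced_words a p" "v \<in> reduced_words b q"
    using reduced_words_nonempty p q by (meson ex_in_conv)
  note u = reduced_wordsD[OF this(1)] and v = reduced_wordsD[OF this(2)]
  let ?w = "u @ map (\<lambda>r. r + a) v"
  note * = parts_concat[OF u(1) v(1)]
  have "word_perm ?w = inflate_12 a p b q"
    using word_perm_parts[OF *(5,6)] unfolding *(1,2) u(3) v(3) .
  then show ?thesis
    using word_perm_permutes[OF *(5)] by simp
qed

lemma parts_reduced_word:
  assumes "w \<in> reduced_words (a + b) (inflate_12 a p b q)"
  shows "a \<notin> set w" "word_perm (low_part a w) = p" "word_perm (high_part a w) = q"
proof -
  note w = reduced_wordsD[OF assms]
  show a: "a \<notin> set w"
    using not_in_reduced_word[OF assms inflate_12_permutes] inflate_12_le_iff[OF p q] by blast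
  have "inflate_12 a (word_perm (low_part a w)) b (word_perm (high_part a w)) = inflate_12 a p b q"
    using word_perm_parts[OF w(1) a] w(3) by simp
  from inflate_12_inject[OF this _ _ p q]
  show "word_perm (low_part a w) = p" "word_perm (high_part a w) = q"
    using parts_letters[OF w(1)] by (blast intro: word_perm_permutes)+
qed

text \<open>Proved with words instead of pairs: concatenating two reduced words gives the upper
  bound, splitting one reduced word into its parts the lower bound.\<close>

lemma inversion_number_inflate_12:
  "inversion_number (a + b) (inflate_12 a p b q) = inversion_number a p + inversion_number b q"
proof (rule antisym)
  obtain u v where "u \<in> reduced_words a p" "v \<in> reduced_words b q"
    using reduced_words_nonempty p q by (meson ex_in_conv)
  note u = reduced_wordsD[OF this(1)] and v = reduced_wordsD[OF this(2)]
  note * = parts_concat[OF u(1) v(1)]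
  have "word_perm (u @ map (\<lambda>r. r + a) v) = inflate_12 a p b q"
    using word_perm_parts[OF *(5,6)] unfolding *(1,2) u(3) v(3) .
  then show "inversion_number (a + b) (inflate_12 a p b q) \<le> inversion_number a p + inversion_number b q"
    using inversion_number_word_perm[OF *(5)] u(2) v(2) by simp
  obtain w where w: "w \<in> reduced_words (a + b) (inflate_12 a p b q)"
    using reduced_words_nonempty inflate_12_permutes by blast
  note parts = parts_letters[OF reduced_wordsD(1)[OF w]]
  show "inversion_number a p + inversion_number b q \<le> inversion_number (a + b) (inflate_12 a p b q)"
    using inversion_number_word_perm[OF parts(1)] inversion_number_word_perm[OF parts(2)]
      parts_reduced_word[OF w] length_parts[of a w] reduced_wordsD(2)[OF w] by simp
qed

text \<open>Neither part can be shorter than its inversion number, and the two lengths add up to the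
  sum of these numbers, so both parts are reduced.\<close>

lemma reduced_words_inflate_12:
  "w \<in> reduced_words (a + b) (inflate_12 a p b q) \<longleftrightarrow>
    set w \<subseteq> {1..<a + b} \<and> a \<notin> set w \<and>
    low_part a w \<in> reduced_words a p \<and> high_part a w \<in> reduced_words b q" (is "?L \<longleftrightarrow> ?R")
proof
  assume w: ?L
  note * = parts_reduced_word[OF w] parts_letters[OF reduced_wordsD(1)[OF w]]
  have "inversion_number a p \<le> length (low_part a w)" "inversion_number b q \<le> length (high_part a w)"
    using inversion_number_word_perm[OF *(4)] inversion_number_word_perm[OF *(5)] *(2,3) by simp_all
  moreover have "length (low_part a w) + length (high_part a w) = inversion_number a p + inversion_number b q"
    using length_parts[OF *(1)] reduced_wordsD(2)[OF w] inversion_number_inflate_12 by simp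
  ultimately have "length (low_part a w) \<le> inversion_number a p"
    "length (high_part a w) \<le> inversion_number b q" by linarith+
  then show ?R
    using * reduced_wordsD(1)[OF w] by (blast intro: reduced_wordsI)
next
  assume w: ?R
  then have "word_perm w = inflate_12 a p b q"
    using word_perm_parts[of w a b] by (auto simp: reduced_words_iff)
  then show ?L
    using w length_parts[of a w] inversion_number_inflate_12
      reduced_wordsD(2)[of "low_part a w"] reduced_wordsD(2)[of "high_part a w"]
    by (intro reduced_wordsI) (auto simp del: length_map)
qed

end

text \<open>The potential for direct sums, before scaling by the commutation cost. It is maximal
  when all low letters come first and 0 when all high letters do; in words without the letter
  \<open>k\<close>, only a swap of a low with a high letter changes it, by one.\<close>

fun low_before_high :: "nat \<Rightarrow> nat list \<Rightarrow> nat" where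
  "low_before_high k [] = 0"
| "low_before_high k (r # w) =
    (if r < k then length (high_part k w) else 0) + low_before_high k w"

lemma low_before_high_append:
  "low_before_high k (u @ v) =
    low_before_high k u + length (low_part k u) * length (high_part k v) + low_before_high k v"
  by (induction u) auto

lemma low_before_high_eq_0:
  "low_part k w = [] \<or> high_part k w = [] \<Longrightarrow> low_before_high k w = 0"
  by (induction w) (auto split: if_splits)

text \<open>Each pair of a low and a high letter is out of order for exactly one of the two targets,
  so the two routes together swap every pair once.\<close>

lemma connects_unshuffle:
  "k \<notin> set w \<Longrightarrow> \<exists>c d. c + d = length (low_part k w) * length (high_part k w) * a \<and>
    connects a b w (low_part k w @ map (\<lambda>r. r + k) (high_part k w)) c \<and>
    connects a b w (map (\<lambda>r. r + k) (high_part k w) @ low_part k w) d"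
proof (induction w)
  case Nil
  then show ?case by (simp add: connects.refl)
next
  case (Cons r w)
  let ?l = "low_part k w" and ?h = "map (\<lambda>r. r + k) (high_part k w)"
  obtain c d where cd: "c + d = length ?l * length ?h * a"
    "connects a b w (?l @ ?h) c" "connects a b w (?h @ ?l) d"
    using Cons by auto
  show ?case
  proof (cases "r < k")
    case True
    have "connects a b (r # ?h) (?h @ [r]) (a * length ?h)"
      by (rule connects_letter_right) (use True in auto)
    from connects_append_right[OF this, of ?l]
    have "connects a b (r # ?h @ ?l) (?h @ r # ?l) (a * length ?h)" by simp
    with connects_Cons[OF cd(3), of r]
    have "connects a b (r # w) (?h @ r # ?l) (d + a * length ?h)" by (rule connects_trans)
    moreover have "connects a b (r # w) (r # ?l @ ?h) c"
      by (rule connects_Cons[OF cd(2)])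
    moreover have "c + (d + a * length ?h) = Suc (length ?l) * length ?h * a"
      using cd(1) by (simp add: algebra_simps)
    ultimately show ?thesis
      using True by auto
  next
    case False
    then have r: "k < r" using Cons.prems by auto
    have "connects a b (r # ?l) (?l @ [r]) (a * length ?l)"
      by (rule connects_letter_right) (use r in auto)
    from connects_append_right[OF this, of ?h]
    have "connects a b (r # ?l @ ?h) (?l @ r # ?h) (a * length ?l)" by simp
    with connects_Cons[OF cd(2), of r]
    have "connects a b (r # w) (?l @ r # ?h) (c + a * length ?l)" by (rule connects_trans)
    moreover have "connects a b (r # w) (r # ?h @ ?l) d"
      by (rule connects_Cons[OF cd(3)])
    moreover have "c + a * length ?l + d = length ?l * Suc (length ?h) * a"
      using cd(1) by (simp add: algebra_simps)
    ultimately show ?thesis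
      using r by auto
  qed
qed

text \<open>A swap on one side of \<open>k\<close> is a move in one projection and keeps the
  potential; a swap across \<open>k\<close> fixes both projections and changes the potential by one
  pair.\<close>

lemma parts_commutation_move:
  assumes "(x, y) \<in> commutation_moves" "k \<notin> set x"
  shows "\<exists>c d. connects a b (low_part k x) (low_part k y) c \<and>
    connects a b (high_part k x) (high_part k y) d \<and>
    low_before_high k x * a + c + d \<le> low_before_high k y * a + a"
  using assms(1)
proof (cases rule: commutation_movesE)
  case (1 u v i j)
  then have ij: "i \<noteq> k" "j \<noteq> k" using assms(2) by auto
  consider "i < k" "j < k" | "k < i" "k < j" | "i < k" "k < j" | "k < i" "j < k"
    using ij by linarith
  then show ?thesis
  proof cases
    assume "i < k" "j < k"
    then show ?thesis
      using connects_comm[OF commutation_movesI[OF 1(3), of "low_part k u" "low_part k v"], of a b]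
        connects.refl[of a b "high_part k x"]
      by (intro exI[of _ a] exI[of _ 0]) (auto simp: 1 low_before_high_append)
  next
    assume "k < i" "k < j"
    then have "\<bar>int (i - k) - int (j - k)\<bar> > 1" using 1(3) by auto
    with \<open>k < i\<close> \<open>k < j\<close> show ?thesis
      using connects_comm[OF commutation_movesI, of "i - k" "j - k" a b "high_part k u" "high_part k v"]
        connects.refl[of a b "low_part k x"]
      by (intro exI[of _ 0] exI[of _ a]) (auto simp: 1 low_before_high_append)
  next
    assume "i < k" "k < j"
    then show ?thesis
      using connects.refl[of a b "low_part k x"] connects.refl[of a b "high_part k x"]
      by (intro exI[of _ 0] exI[of _ 0]) (auto simp: 1 low_before_high_append algebra_simps)
  next
    assume "k < i" "j < k"
    then show ?thesis
      using connects.refl[of a b "low_part k x"] connects.refl[of a b "high_part k x"]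
      by (intro exI[of _ 0] exI[of _ 0]) (auto simp: 1 low_before_high_append algebra_simps)
  qed
qed

text \<open>The letters j and j + 1 lie on the same side of the missing letter \<open>k\<close>, so
  the move takes place in one projection and the potential is constant.\<close>

lemma parts_braid_move:
  assumes "(x, y) \<in> braid_moves" "k \<notin> set x"
  shows "\<exists>c d. connects a b (low_part k x) (low_part k y) c \<and>
    connects a b (high_part k x) (high_part k y) d \<and>
    low_before_high k x * a + c + d \<le> low_before_high k y * a + b"
proof -
  obtain u v j where xy: "x = u @ [j, j + 1, j] @ v \<and> y = u @ [j + 1, j, j + 1] @ v \<or>
      x = u @ [j + 1, j, j + 1] @ v \<and> y = u @ [j, j + 1, j] @ v"
    using braid_movesE[OF assms(1)] by metis
  with assms(2) have "j + 1 < k \<or> k < j" by auto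
  then show ?thesis
  proof
    assume "j + 1 < k"
    then show ?thesis
      using xy connects_braid[OF braid_movesI(1)[of "low_part k u" j "low_part k v"], of a b]
        connects_braid[OF braid_movesI(2)[of "low_part k u" j "low_part k v"], of a b]
        connects.refl[of a b "high_part k x"]
      by (intro exI[of _ b] exI[of _ 0]) (auto simp: low_before_high_append)
  next
    assume "k < j"
    then show ?thesis
      using xy connects_braid[OF braid_movesI(1)[of "high_part k u" "j - k" "high_part k v"], of a b]
        connects_braid[OF braid_movesI(2)[of "high_part k u" "j - k" "high_part k v"], of a b]
        connects.refl[of a b "low_part k x"]
      by (intro exI[of _ 0] exI[of _ b]) (auto simp: low_before_high_append Suc_diff_le)
  qed
qed

lemma word_diam_inflate_12:
  assumes p: "p permutes {1..k}" and q: "q permutes {1..l}"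
  shows "word_diam a b (reduced_words (k + l) (inflate_12 k p l q)) =
    word_diam a b (reduced_words k p) + word_diam a b (reduced_words l q) +
    ereal (real (inversion_number k p * inversion_number l q * a))"
proof (rule word_diam_product[where f = "low_part k" and g = "high_part k"
      and h = "\<lambda>w. low_before_high k w * a"
      and I = "\<lambda>u v. u @ map (\<lambda>r. r + k) v" and J = "\<lambda>u v. map (\<lambda>r. r + k) v @ u"])
  let ?V = "reduced_words (k + l) (inflate_12 k p l q)"
  note iff = reduced_words_inflate_12[OF p q]
  show "finite (reduced_words k p)" "finite (reduced_words l q)"
    by (rule finite_reduced_words)+
  show "reduced_words k p \<noteq> {}" "reduced_words l q \<noteq> {}"
    using p q by (blast dest: reduced_words_nonempty)+
  show "x \<in> ?V \<Longrightarrow> (x, y) \<in> commutation_moves \<union> braid_moves \<Longrightarrow> y \<in> ?V" for x y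
    by (rule reduced_words_move)
  show "x \<in> ?V \<Longrightarrow> low_part k x \<in> reduced_words k p" "x \<in> ?V \<Longrightarrow> high_part k x \<in> reduced_words l q" for x
    by (simp_all only: iff)
  fix u v
  assume u: "u \<in> reduced_words k p" and v: "v \<in> reduced_words l q"
  note * = parts_concat[OF reduced_wordsD(1)[OF u] reduced_wordsD(1)[OF v]]
  have **: "set (map (\<lambda>r. r + k) v @ u) \<subseteq> {1..<k + l}" "k \<notin> set (map (\<lambda>r. r + k) v @ u)"
    using *(5,6) by auto
  have parts: "low_part k u = u" "high_part k (map (\<lambda>r. r + k) v) = v" 
    "high_part k u = []" "low_part k (map (\<lambda>r. r + k) v) = []"
    using parts_concat[OF reduced_wordsD(1)[OF u], of "[]" l]
      parts_concat[OF _ reduced_wordsD(1)[OF v], of "[]" k] by simp_all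
  have h0: "low_before_high k u = 0" "low_before_high k (map (\<lambda>r. r + k) v) = 0"
    using parts by (auto intro: low_before_high_eq_0)
  show "u @ map (\<lambda>r. r + k) v \<in> ?V \<and>
      low_part k (u @ map (\<lambda>r. r + k) v) = u \<and> high_part k (u @ map (\<lambda>r. r + k) v) = v \<and>
      low_before_high k (u @ map (\<lambda>r. r + k) v) * a = inversion_number k p * inversion_number l q * a"
    unfolding iff *(1,2) low_before_high_append parts h0
    using *(5,6) u v reduced_wordsD(2)[OF u] reduced_wordsD(2)[OF v] by simp
  show "map (\<lambda>r. r + k) v @ u \<in> ?V \<and>
      low_part k (map (\<lambda>r. r + k) v @ u) = u \<and> high_part k (map (\<lambda>r. r + k) v @ u) = v \<and>
      low_before_high k (map (\<lambda>r. r + k) v @ u) * a = 0"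
    unfolding iff *(3,4) low_before_high_append parts h0
    using ** u v by simp
next
  fix u v u' v' c d
  assume "connects a b u u' c" "connects a b v v' d"
  note u = this(1) and v = connects_shift[OF this(2), of k]
  show "connects a b (u @ map (\<lambda>r. r + k) v) (u' @ map (\<lambda>r. r + k) v') (c + d)"
    using connects_trans[OF connects_append_right[OF u] connects_append_left[OF v]] .
  show "connects a b (map (\<lambda>r. r + k) v @ u) (map (\<lambda>r. r + k) v' @ u') (c + d)"
    using connects_trans[OF connects_append_left[OF u] connects_append_right[OF v]] .
next
  fix x
  assume "x \<in> reduced_words (k + l) (inflate_12 k p l q)"
  then have x: "k \<notin> set x" "low_part k x \<in> reduced_words k p" "high_part k x \<in> reduced_words l q"
    unfolding reduced_words_inflate_12[OF p q] by auto
  show "\<exists>c d. c + d = inversion_number k p * inversion_number l q * a \<and>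
      connects a b x (low_part k x @ map (\<lambda>r. r + k) (high_part k x)) c \<and>
      connects a b x (map (\<lambda>r. r + k) (high_part k x) @ low_part k x) d"
    using connects_unshuffle[OF x(1), of a b]
    unfolding reduced_wordsD(2)[OF x(2)] reduced_wordsD(2)[OF x(3)] .
  show "\<exists>c d. connects a b (low_part k x) (low_part k y) c \<and>
      connects a b (high_part k x) (high_part k y) d \<and>
      low_before_high k x * a + c + d \<le> low_before_high k y * a + a"
    if "(x, y) \<in> commutation_moves" for y
    using parts_commutation_move[OF that x(1)] .
  show "\<exists>c d. connects a b (low_part k x) (low_part k y) c \<and>
      connects a b (high_part k x) (high_part k y) d \<and>
      low_before_high k x * a + c + d \<le> low_before_high k y * a + b"
    if "(x, y) \<in> braid_moves" for y
    using parts_braid_move[OF that x(1)] .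
qed

section \<open>Removing the strand of the value 1\<close>

declare upt_Suc [simp del]

text \<open>
  Letters are read from left to right, and the state \<open>i\<close> means that the strand of the value 1 is at
  position \<open>i + 1\<close>. It is moved by the letters \<open>i + 1\<close> (up) and \<open>i\<close> (down); once it is erased, the crossings
  above it move down by one.
\<close>

definition strand_step :: "nat \<Rightarrow> nat \<Rightarrow> nat" where
  "strand_step i r = (if r = i + 1 then i + 1 else if r = i then i - 1 else i)"

fun strand :: "nat \<Rightarrow> nat list \<Rightarrow> nat" where
  "strand i [] = i"
| "strand i (r # w) = strand (strand_step i r) w"

fun remove_strand :: "nat \<Rightarrow> nat list \<Rightarrow> nat list" where
  "remove_strand i [] = []"
| "remove_strand i (r # w) =
    (if r = i + 1 \<or> r = i then [] else if r < i then [r] else [r - 1]) @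
    remove_strand (strand_step i r) w"

fun strand_rises :: "nat \<Rightarrow> nat list \<Rightarrow> bool" where
  "strand_rises i [] \<longleftrightarrow> True"
| "strand_rises i (r # w) \<longleftrightarrow> r \<noteq> i \<and> strand_rises (strand_step i r) w"

text \<open>The cost of carrying all other crossings to the left of the strand.\<close>

fun strand_cost :: "nat \<Rightarrow> nat \<Rightarrow> nat \<Rightarrow> nat list \<Rightarrow> nat" where
  "strand_cost a b i [] = 0"
| "strand_cost a b i (r # w) =
    (if r = i + 1 then 0 else if r < i then (i - 2) * a + b else i * a) +
    strand_cost a b (strand_step i r) w"

lemma strand_append:
  "strand i (u @ v) = strand (strand i u) v"
  "remove_strand i (u @ v) = remove_strand i u @ remove_strand (strand i u) v"
  "strand_rises i (u @ v) \<longleftrightarrow> strand_rises i u \<and> strand_rises (strand i u) v"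
  "strand_cost a b i (u @ v) = strand_cost a b i u + strand_cost a b (strand i u) v"
  by (induction u arbitrary: i) auto

text \<open>The extreme word with every crossing after the strand has this shape: each crossing pays
  for sweeping back over the whole run 1, ..., i, that is, one long braid move and i - 2
  commutations.\<close>

lemma strand_low:
  "set w \<subseteq> {1..<i} \<Longrightarrow> strand i w = i"
  "set w \<subseteq> {1..<i} \<Longrightarrow> remove_strand i w = w"
  "set w \<subseteq> {1..<i} \<Longrightarrow> strand_cost a b i w = length w * ((i - 2) * a + b)"
  by (induction w) (auto simp: strand_step_def)

text \<open>The opposite extreme: as long as the strand has not moved, every crossing lies above it
  and there is nothing to pay.\<close>

lemma strand_high:
  "set w \<subseteq> {1..} \<Longrightarrow> strand 0 (map Suc w) = 0"
  "set w \<subseteq> {1..} \<Longrightarrow> remove_strand 0 (map Suc w) = w"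
  "set w \<subseteq> {1..} \<Longrightarrow> strand_cost a b 0 (map Suc w) = 0"
  by (induction w) (auto simp: strand_step_def)

lemma strand_run:
  "strand i [i + 1..<i + 1 + d] = i + d"
  "remove_strand i [i + 1..<i + 1 + d] = []"
  "strand_cost a b i [i + 1..<i + 1 + d] = 0"
proof (induction d)
  case (Suc d)
  { case 1 then show ?case using Suc by (simp add: strand_append strand_step_def upt_Suc) }
  { case 2 then show ?case using Suc by (simp add: strand_append strand_step_def upt_Suc) }
  { case 3 then show ?case using Suc by (simp add: strand_append strand_step_def upt_Suc) }
qed simp_all

lemma strand_letters:
  assumes "set w \<subseteq> {1..<Suc k}" "i \<le> k"
  shows "strand i w \<le> k \<and> set (remove_strand i w) \<subseteq> {1..<k}"
  using assms
proof (induction w arbitrary: i)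
  case (Cons r w)
  have "strand_step i r \<le> k"
    using Cons.prems by (auto simp: strand_step_def)
  with Cons show ?case by auto
qed simp

text \<open>A rise trades one letter for one step of the strand and a crossing survives, whereas a
  fall loses both a letter and a step. Hence equality excludes falls.\<close>

lemma length_remove_strand:
  assumes "0 \<notin> set w"
  shows "length (remove_strand i w) + strand i w \<le> length w + i \<and>
    (length (remove_strand i w) + strand i w = length w + i \<longrightarrow> strand_rises i w)"
  using assms
proof (induction w arbitrary: i)
  case (Cons r w)
  then have "r \<noteq> 0" by auto
  then show ?case
    using Cons.IH[of "strand_step i r"] Cons.prems by (auto simp: strand_step_def split: if_splits)
qed simp

text \<open>The strand sweeping over positions \<open>lo, \<dots>, hi + 1\<close> meets the crossing \<open>r\<close> in one braid move.\<close>

lemma connects_letter_run: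
  assumes "lo \<le> r" "r < hi"
  shows "connects a b ([lo..<Suc hi] @ [r]) (Suc r # [lo..<Suc hi]) ((hi - lo - 1) * a + b)"
proof -
  let ?u = "[lo..<r]" and ?v = "[r + 2..<Suc hi]"
  have "[lo..<Suc hi] = [lo..<r] @ [r..<Suc hi]"
    using upt_add_eq_append[of lo r "Suc hi - r"] assms by simp
  also have "[r..<Suc hi] = r # (r + 1) # ?v"
    using assms by (simp add: upt_rec)
  finally have run: "[lo..<Suc hi] = ?u @ r # (r + 1) # ?v" .
  have "connects a b (r # ?v) (?v @ [r]) (a * length ?v)"
    by (rule connects_letter_right) auto
  from connects_append_left[OF connects_sym[OF this], of "?u @ [r, r + 1]"]
  have 1: "connects a b (?u @ [r, r + 1] @ ?v @ [r]) (?u @ [r, r + 1, r] @ ?v) (a * length ?v)"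
    by simp
  have 2: "connects a b (?u @ [r, r + 1, r] @ ?v) (?u @ [r + 1, r, r + 1] @ ?v) b"
    by (rule connects_braid[OF braid_movesI(1)])
  have "connects a b ((r + 1) # ?u) (?u @ [r + 1]) (a * length ?u)"
    by (rule connects_letter_right) auto
  from connects_append_right[OF connects_sym[OF this], of "[r, r + 1] @ ?v"]
  have 3: "connects a b (?u @ [r + 1, r, r + 1] @ ?v) ((r + 1) # ?u @ [r, r + 1] @ ?v) (a * length ?u)"
    by simp
  have cost: "a * length ?v + (b + a * length ?u) = (hi - lo - 1) * a + b"
  proof -
    have "length ?v + length ?u = hi - lo - 1" using assms by auto
    then show ?thesis by (metis add.assoc add.commute distrib_right mult.commute)
  qed
  show ?thesis
    using connects_trans[OF 1 connects_trans[OF 2 3]] unfolding cost run by simp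
qed

text \<open>The run \<open>[1..<Suc i]\<close> carries the value 1 to position i + 1. A rise
  lengthens this run, a fall cancels its last letter, and any other crossing is pulled to the left
  through it, where a crossing from below the strand emerges one higher.\<close>

lemma word_perm_remove_strand:
  assumes "0 \<notin> set w"
  shows "word_perm ([1..<Suc i] @ w) =
    word_perm (map Suc (remove_strand i w) @ [1..<Suc (strand i w)])"
  using assms
proof (induction w arbitrary: i)
  case (Cons r w)
  then have r: "1 \<le> r" and w: "0 \<notin> set w" by (auto simp: Suc_le_eq)
  consider "r = i + 1" | "r = i" | "r < i" | "i + 1 < r" by linarith
  then show ?case
  proof cases
    assume "r = i + 1"
    then show ?thesis
      using Cons.IH[OF w, of "i + 1"] by (simp add: strand_step_def upt_Suc[of "Suc 0" "Suc i"])
  next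
    assume "r = i"
    then have "[1..<Suc i] = [1..<Suc (i - 1)] @ [i]" using r by (cases i) (auto simp: upt_Suc)
    then have "word_perm ([1..<Suc i] @ r # w) = word_perm ([1..<Suc (i - 1)] @ w)"
      by (simp add: \<open>r = i\<close> word_perm_append word_perm_Cons fun_eq_iff)
    then show ?thesis
      using Cons.IH[OF w, of "i - 1"] r \<open>r = i\<close> by (simp add: strand_step_def)
  next
    assume "r < i"
    have "word_perm (([1..<Suc i] @ [r]) @ w) = word_perm ((Suc r # [1..<Suc i]) @ w)"
      using connects_word_perm[OF connects_letter_run[OF r \<open>r < i\<close>]]
      unfolding word_perm_append[of _ w] by simp
    then show ?thesis
      using Cons.IH[OF w, of i] \<open>r < i\<close> by (simp add: strand_step_def word_perm_Cons)
  next
    assume "i + 1 < r"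
    \<comment> \<open>Only the permutation matters here, so the costs are set to 0.\<close>
    then have "connects 0 0 (r # [1..<Suc i]) ([1..<Suc i] @ [r]) (0 * length [1..<Suc i])"
      by (intro connects_letter_right) auto
    from connects_word_perm[OF this]
    have "word_perm (([1..<Suc i] @ [r]) @ w) = word_perm ((r # [1..<Suc i]) @ w)"
      unfolding word_perm_append[of _ w] by simp
    then show ?thesis
      using Cons.IH[OF w, of i] \<open>i + 1 < r\<close> by (simp add: strand_step_def word_perm_Cons)
  qed
qed simp

text \<open>Prepending the distance already travelled, 1, ..., i, lets the induction start at any
  state; for i = 0 it is empty and both routes start at \<open>w\<close>. A crossing passes i + 1,
  ..., k on the way to the first target and 1, ..., i on the way to the second. Its braid move
  belongs to the second route if it lies below the strand and to the first if above, and the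
  commutations of both routes add up to k - 2.\<close>

lemma connects_strand_left:
  assumes "set w \<subseteq> {1..k}" "strand i w = k" "strand_rises i w" "i \<le> k"
  shows "\<exists>c d. c + d = length (remove_strand i w) * ((k - 2) * a + b) \<and>
    connects a b w ([Suc i..<Suc k] @ remove_strand i w) c \<and>
    connects a b ([1..<Suc i] @ w) (map Suc (remove_strand i w) @ [1..<Suc k]) d"
  using assms
proof (induction w arbitrary: i)
  case Nil
  then show ?case by (simp add: connects.refl)
next
  case (Cons r w)
  then have r: "1 \<le> r" "r \<le> k" and w: "set w \<subseteq> {1..k}" by auto
  let ?c = "(k - 2) * a + b"
  consider "r = i + 1" | "r < i" | "i + 1 < r" using Cons.prems(3) by fastforce
  then show ?case
  proof cases
    assume ri: "r = i + 1"
    then have "i + 1 \<le> k" using r by simp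
    then obtain c d where cd: "c + d = length (remove_strand (i + 1) w) * ?c"
      "connects a b w ([Suc (i + 1)..<Suc k] @ remove_strand (i + 1) w) c"
      "connects a b ([1..<Suc (i + 1)] @ w) (map Suc (remove_strand (i + 1) w) @ [1..<Suc k]) d"
      using Cons.IH[OF w, of "i + 1"] Cons.prems ri by (auto simp: strand_step_def)
    have "[Suc i..<Suc k] = (i + 1) # [Suc (i + 1)..<Suc k]"
      using \<open>i + 1 \<le> k\<close> by (simp add: upt_rec)
    then show ?thesis
      using cd(1,3) connects_Cons[OF cd(2), of r] ri
      by (intro exI[of _ c] exI[of _ d]) (simp add: strand_step_def upt_Suc[of "Suc 0" "Suc i"])
  next
    assume ri: "r < i"
    obtain c d where cd: "c + d = length (remove_strand i w) * ?c"
      "connects a b w ([Suc i..<Suc k] @ remove_strand i w) c"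
      "connects a b ([1..<Suc i] @ w) (map Suc (remove_strand i w) @ [1..<Suc k]) d"
      using Cons.IH[OF w, of i] Cons.prems ri by (auto simp: strand_step_def)
    have "connects a b (r # [Suc i..<Suc k]) ([Suc i..<Suc k] @ [r]) (a * length [Suc i..<Suc k])"
      using ri by (intro connects_letter_right) auto
    from connects_trans[OF connects_Cons[OF cd(2)]
        connects_append_right[OF this, of "remove_strand i w", simplified append_Cons append_assoc]]
    have 1: "connects a b (r # w) ([Suc i..<Suc k] @ r # remove_strand i w) (c + a * (k - i))"
      by simp
    from connects_trans[OF connects_append_right[OF connects_letter_run[OF r(1) ri], of a b w]
        connects_Cons[OF cd(3), of "Suc r", folded append_Cons]]
    have 2: "connects a b ([1..<Suc i] @ r # w)
        (Suc r # map Suc (remove_strand i w) @ [1..<Suc k]) ((i - 1 - 1) * a + b + d)"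
      by simp
    have "k - 2 = (k - i) + (i - 2)"
      using ri r Cons.prems(4) by simp
    then have "?c = a * (k - i) + ((i - 1 - 1) * a + b)"
      by (simp add: algebra_simps numeral_2_eq_2)
    then have "(c + a * (k - i)) + ((i - 1 - 1) * a + b + d) = Suc (length (remove_strand i w)) * ?c"
      using cd(1) by simp
    with 1 2 show ?thesis
      using ri by (intro exI[of _ "c + a * (k - i)"] exI[of _ "(i - 1 - 1) * a + b + d"])
        (simp add: strand_step_def)
  next
    assume ri: "i + 1 < r"
    obtain c d where cd: "c + d = length (remove_strand i w) * ?c"
      "connects a b w ([Suc i..<Suc k] @ remove_strand i w) c"
      "connects a b ([1..<Suc i] @ w) (map Suc (remove_strand i w) @ [1..<Suc k]) d"
      using Cons.IH[OF w, of i] Cons.prems ri by (auto simp: strand_step_def)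
    have *: "Suc i \<le> r - 1" "r - 1 < k" "Suc (r - 1) = r" using ri r by auto
    have "connects a b (r # [Suc i..<Suc k]) ([Suc i..<Suc k] @ [r - 1]) ((k - Suc i - 1) * a + b)"
      using connects_sym[OF connects_letter_run[OF *(1,2)]] unfolding *(3) .
    from connects_trans[OF connects_Cons[OF cd(2)]
        connects_append_right[OF this, of "remove_strand i w", simplified append_Cons append_assoc]]
    have 1: "connects a b (r # w) ([Suc i..<Suc k] @ (r - 1) # remove_strand i w)
        (c + ((k - Suc i - 1) * a + b))"
      by simp
    have "connects a b (r # [1..<Suc i]) ([1..<Suc i] @ [r]) (a * length [1..<Suc i])"
      using ri by (intro connects_letter_right) auto
    from connects_trans[OF connects_append_right[OF connects_sym[OF this], of w]
        connects_Cons[OF cd(3), of r, folded append_Cons]]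
    have 2: "connects a b ([1..<Suc i] @ r # w)
        (r # map Suc (remove_strand i w) @ [1..<Suc k]) (a * i + d)"
      by simp
    have "k - 2 = i + (k - Suc i - 1)"
      using ri r by simp
    then have "?c = ((k - Suc i - 1) * a + b) + a * i"
      by (simp add: algebra_simps)
    then have "(c + ((k - Suc i - 1) * a + b)) + (a * i + d) = Suc (length (remove_strand i w)) * ?c"
      using cd(1) by simp
    with 1 2 show ?thesis
      using ri *(3) by (intro exI[of _ "c + ((k - Suc i - 1) * a + b)"] exI[of _ "a * i + d"])
        (simp add: strand_step_def)
  qed
qed

text \<open>Swapping a rise with a crossing changes the state at which this crossing is met by one,
  and so its price by one commutation. If neither letter moves the strand, the move survives in the
  projection and all prices stay.\<close>

lemma strand_commutation_move:
  assumes "(x, y) \<in> commutation_moves" "0 \<notin> set x" "strand_rises i x"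
  shows "\<exists>c. connects a b (remove_strand i x) (remove_strand i y) c \<and>
    strand_cost a b i x + c \<le> strand_cost a b i y + a"
  using assms(1)
proof (cases rule: commutation_movesE)
  case (1 u v j l)
  define s where "s = strand i u"
  have rises: "strand_rises s (j # l # v)"
    using assms(3) by (simp add: 1 strand_append s_def)
  then have j: "j \<noteq> s" and l: "l \<noteq> s"
    using 1(3) by (auto simp: strand_step_def split: if_splits)
  have l0: "1 \<le> l" using assms(2) 1 by (auto simp: Suc_le_eq)
  show ?thesis
  proof (cases "j = s + 1 \<or> l = s + 1")
    case True
    have st: "strand_step (strand_step s j) l = strand_step (strand_step s l) j"
      "remove_strand s [j, l] = remove_strand s [l, j]"
      using True j l 1(3) by (auto simp: strand_step_def)
    have "strand_cost a b s [j, l] \<le> strand_cost a b s [l, j] + a"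
    proof (cases "l < s")
      case True
      \<comment> \<open>Here 1 \<le> l < s, so s \<ge> 2 and the truncated differences do differ by
        one.\<close>
      then have "s - 1 = Suc (s - 2)" using l0 by simp
      then show ?thesis
        using True \<open>j = s + 1 \<or> l = s + 1\<close> by (auto simp: strand_step_def)
    next
      case False
      then show ?thesis
        using \<open>j = s + 1 \<or> l = s + 1\<close> j l 1(3) by (auto simp: strand_step_def algebra_simps)
    qed
    moreover have "strand s [j, l] = strand s [l, j]" using st(1) by simp
    ultimately show ?thesis
      using connects.refl[of a b "remove_strand i x"]
      unfolding 1 strand_append s_def[symmetric] st(2) by (intro exI[of _ 0]) simp
  next
    case False
    define j' l' where "j' = (if j < s then j else j - 1)" and "l' = (if l < s then l else l - 1)"
    have "\<bar>int j' - int l'\<bar> > 1"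
      using False j l 1(3) unfolding j'_def l'_def by auto
    from connects_comm[OF commutation_movesI[OF this], of a b "remove_strand i u" "remove_strand s v"]
    show ?thesis
      using False j l
      by (intro exI[of _ a]) (auto simp: 1 strand_append s_def[symmetric] strand_step_def j'_def l'_def)
  qed
qed

text \<open>A strand that never falls takes part in the move only for j = s + 1, s being its state:
  it rises twice, and the remaining crossing changes between lying above it, at price s * a, and
  below it, at price (s + 2 - 2) * a + b. The projection does not notice.\<close>

lemma strand_braid_move:
  assumes "(x, y) \<in> braid_moves" "strand_rises i x"
  shows "\<exists>c. connects a b (remove_strand i x) (remove_strand i y) c \<and>
    strand_cost a b i x + c \<le> strand_cost a b i y + b"
proof -
  obtain u v j where xy: "x = u @ [j, j + 1, j] @ v \<and> y = u @ [j + 1, j, j + 1] @ v \<or>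
      x = u @ [j + 1, j, j + 1] @ v \<and> y = u @ [j, j + 1, j] @ v"
    using braid_movesE[OF assms(1)] by metis
  define s where "s = strand i u"
  have "strand_rises s [j, j + 1, j] \<or> strand_rises s [j + 1, j, j + 1]"
    using assms(2) xy by (auto simp: strand_append s_def)
  then consider "j = s + 1" | "j + 1 < s" | "s + 1 < j"
    by (fastforce simp: strand_step_def split: if_splits)
  then show ?thesis
  proof cases
    assume "j = s + 1"
    then show ?thesis
      using xy connects.refl[of a b]
      by (intro exI[of _ 0]) (auto simp: strand_append s_def[symmetric] strand_step_def)
  next
    assume "j + 1 < s"
    then show ?thesis
      using xy connects_braid[OF braid_movesI(1)[of "remove_strand i u" j "remove_strand s v"], of a b]
        connects_braid[OF braid_movesI(2)[of "remove_strand i u" j "remove_strand s v"], of a b]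
      by (intro exI[of _ b]) (auto simp: strand_append s_def[symmetric] strand_step_def)
  next
    assume "s + 1 < j"
    then have "j - 1 + 1 = j" by simp
    with \<open>s + 1 < j\<close> show ?thesis
      using xy connects_braid[OF braid_movesI(1)[of "remove_strand i u" "j - 1" "remove_strand s v"], of a b]
        connects_braid[OF braid_movesI(2)[of "remove_strand i u" "j - 1" "remove_strand s v"], of a b]
      by (intro exI[of _ b]) (auto simp: strand_append s_def[symmetric] strand_step_def)
  qed
qed

section \<open>Reduced words of 21[p, 1]\<close>

lemma word_perm_run:
  "word_perm [1..<Suc k] i = (if i \<in> {1..k} then i + 1 else if i = k + 1 then 1 else i)"
proof (induction k arbitrary: i)
  case (Suc k)
  have "word_perm [1..<Suc (Suc k)] i = word_perm [1..<Suc k] (transpose (k + 1) (k + 2) i)"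
    by (simp add: upt_Suc[of "Suc 0" "Suc k"] word_perm_append word_perm_Cons)
  then show ?case
    unfolding Suc by (auto simp: transpose_def)
qed simp

lemma word_perm_fixes: "\<forall>r\<in>set w. i < r \<Longrightarrow> word_perm w i = i"
  by (induction w) (auto simp: word_perm_Cons transpose_apply_other)

context
  fixes k :: nat and p :: "nat \<Rightarrow> nat"
  assumes p: "p permutes {1..k}"
begin

text \<open>The run lifts the values 1, ..., k by one and sends k + 1, a fixed point of
  \<open>p\<close>, to 1.\<close>

lemma inflate_21_run: "inflate_21 k p 1 id = word_perm [1..<Suc k] \<circ> p"
proof
  fix i
  show "inflate_21 k p 1 id i = (word_perm [1..<Suc k] \<circ> p) i"
    using permutes_in_image[OF p, of i] permutes_not_in[OF p, of i]
    by (auto simp: inflate_21_def word_perm_run simp del: One_nat_def)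
qed

lemma word_perm_inflate_21:
  assumes "set u \<subseteq> {1..<k}" "word_perm u = p"
  shows "word_perm ([1..<Suc k] @ u) = inflate_21 k p 1 id"
    "word_perm (map Suc u @ [1..<Suc k]) = inflate_21 k p 1 id"
proof -
  show *: "word_perm ([1..<Suc k] @ u) = inflate_21 k p 1 id"
    unfolding word_perm_append assms(2) inflate_21_run ..
  have "0 \<notin> set u" using assms(1) by auto
  \<comment> \<open>At state k all letters of \<open>u\<close> lie below the strand, so erasing it
    changes nothing and the run passes \<open>u\<close> by shifting it.\<close>
  from word_perm_remove_strand[OF this, of k]
  show "word_perm (map Suc u @ [1..<Suc k]) = inflate_21 k p 1 id"
    unfolding strand_low(1,2)[OF assms(1)] * by simp
qed

lemma inflate_21_permutes: "inflate_21 k p 1 id permutes {1..Suc k}"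
proof -
  have "set [1..<Suc k] \<subseteq> {1..<Suc k}" by auto
  from word_perm_permutes[OF this] show ?thesis
    unfolding inflate_21_run
    by (intro permutes_compose permutes_subset[OF p]) auto
qed

text \<open>The shifted crossings fix 1, so the final state alone decides where the value 1 stands,
  and in 21[p, 1] it stands at k + 1. Cancelling the run then leaves \<open>p\<close>.\<close>

lemma strand_of_word:
  assumes w: "set w \<subseteq> {1..<Suc k}" "word_perm w = inflate_21 k p 1 id"
  shows "strand 0 w = k" "word_perm (remove_strand 0 w) = p"
proof -
  let ?v = "remove_strand 0 w" and ?s = "strand 0 w"
  have letters: "?s \<le> k" "set ?v \<subseteq> {1..<k}"
    using strand_letters[of w k 0] w(1) by auto
  have "0 \<notin> set w" using w(1) by auto
  from word_perm_remove_strand[OF this, of 0]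
  have eq: "inflate_21 k p 1 id = word_perm (map Suc ?v) \<circ> word_perm [1..<Suc ?s]"
    by (simp add: w(2) word_perm_append)
  have inj: "inj (word_perm u)" if "set u \<subseteq> {1..<n}" for u n
    using word_perm_permutes[OF that] by (rule permutes_inj)
  have "inflate_21 k p 1 id (k + 1) = 1" by (simp add: inflate_21_def)
  moreover have "word_perm (map Suc ?v) 1 = 1"
    using letters(2) by (intro word_perm_fixes) auto
  ultimately have "word_perm (map Suc ?v) (word_perm [1..<Suc ?s] (k + 1)) = word_perm (map Suc ?v) 1"
    unfolding eq by simp
  moreover have "inj (word_perm (map Suc ?v))"
    using letters(2) by (intro inj[of _ "Suc k"]) auto
  ultimately have "word_perm [1..<Suc ?s] (k + 1) = 1"
    by (simp only: inj_eq)
  then show s: "?s = k"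
    using letters(1) unfolding word_perm_run by (auto split: if_splits)
  have "0 \<notin> set ?v" using letters(2) by auto
  from word_perm_remove_strand[OF this, of k]
  have "word_perm [1..<Suc k] \<circ> word_perm ?v = word_perm [1..<Suc k] \<circ> p"
    unfolding strand_low(1,2)[OF letters(2)] word_perm_append inflate_21_run[symmetric] eq s .
  moreover have "inj (word_perm [1..<Suc k])"
    by (rule inj[of _ "Suc k"]) auto
  ultimately show "word_perm ?v = p"
    by (simp add: fun_eq_iff inj_eq)
qed

lemma inversion_number_inflate_21:
  "inversion_number (Suc k) (inflate_21 k p 1 id) = inversion_number k p + k"
proof (rule antisym)
  obtain u where "u \<in> reduced_words k p"
    using reduced_words_nonempty p by blast
  note u = reduced_wordsD[OF this]
  have "set ([1..<Suc k] @ u) \<subseteq> {1..<Suc k}" using u(1) by auto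
  from inversion_number_word_perm[OF this]
  show "inversion_number (Suc k) (inflate_21 k p 1 id) \<le> inversion_number k p + k"
    unfolding word_perm_inflate_21(1)[OF u(1,3)] using u(2) by simp
  obtain w where "w \<in> reduced_words (Suc k) (inflate_21 k p 1 id)"
    using reduced_words_nonempty inflate_21_permutes by blast
  note w = reduced_wordsD[OF this]
  have "set (remove_strand 0 w) \<subseteq> {1..<k}"
    using strand_letters[of w k 0] w(1) by auto
  from inversion_number_word_perm[OF this]
  show "inversion_number k p + k \<le> inversion_number (Suc k) (inflate_21 k p 1 id)"
    using length_remove_strand[of w 0] strand_of_word[OF w(1,3)] w(1,2) by fastforce
qed

text \<open>Bringing the strand to state k takes at least k letters, so at most l(p) remain; fewer
  cannot represent \<open>p\<close>. Hence the rest is reduced and no letter was spent on a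
  fall.\<close>

lemma reduced_words_inflate_21:
  assumes "w \<in> reduced_words (Suc k) (inflate_21 k p 1 id)"
  shows "remove_strand 0 w \<in> reduced_words k p" "strand_rises 0 w" "strand 0 w = k"
proof -
  note w = reduced_wordsD[OF assms]
  show s: "strand 0 w = k" by (rule strand_of_word[OF w(1,3)])
  have v: "set (remove_strand 0 w) \<subseteq> {1..<k}"
    using strand_letters[of w k 0] w(1) by auto
  have p': "word_perm (remove_strand 0 w) = p" by (rule strand_of_word[OF w(1,3)])
  have w0: "0 \<notin> set w" using w(1) by auto
  have le: "inversion_number k p \<le> length (remove_strand 0 w)"
    using inversion_number_word_perm[OF v] p' by simp
  then show "remove_strand 0 w \<in> reduced_words k p"
    using length_remove_strand[OF w0, of 0] w(2) s inversion_number_inflate_21 v p'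
    by (intro reduced_wordsI) auto
  show "strand_rises 0 w"
    using length_remove_strand[OF w0, of 0] w(2) s inversion_number_inflate_21 le by linarith
qed

lemma word_diam_inflate_21:
  "word_diam a b (reduced_words (Suc k) (inflate_21 k p 1 id)) =
    word_diam a b (reduced_words k p) + ereal (real (inversion_number k p * ((k - 2) * a + b)))"
proof -
  let ?V = "reduced_words (Suc k) (inflate_21 k p 1 id)"
  let ?K = "inversion_number k p * ((k - 2) * a + b)"
  \<comment> \<open>The second factor is trivial: the permutation of size 1 has only the empty word,
    and its diameter is 0.\<close>
  have "word_diam a b ?V = word_diam a b (reduced_words k p) + word_diam a b {[]} + ereal (real ?K)"
  proof (rule word_diam_product[where f = "remove_strand 0" and g = "\<lambda>_. []"
        and h = "strand_cost a b 0" and I = "\<lambda>u v. [1..<Suc k] @ u @ v"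
        and J = "\<lambda>u v. map Suc u @ [1..<Suc k] @ v"])
    show "finite (reduced_words k p)" by (rule finite_reduced_words)
    show "reduced_words k p \<noteq> {}" by (rule reduced_words_nonempty[OF p])
    show "x \<in> ?V \<Longrightarrow> (x, y) \<in> commutation_moves \<union> braid_moves \<Longrightarrow> y \<in> ?V" for x y
      by (rule reduced_words_move)
    show "x \<in> ?V \<Longrightarrow> remove_strand 0 x \<in> reduced_words k p" for x
      by (rule reduced_words_inflate_21)
    fix u v :: "nat list"
    assume "u \<in> reduced_words k p" and v: "v \<in> {[]}"
    note u = reduced_wordsD[OF this(1)]
    have u1: "set u \<subseteq> {1..}" using u(1) by auto
    have run: "strand 0 [1..<Suc k] = k" "remove_strand 0 [1..<Suc k] = []"
      "strand_cost a b 0 [1..<Suc k] = 0"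
      using strand_run[of 0 k] strand_run(3)[of a b 0 k] by simp_all
    show "[1..<Suc k] @ u @ v \<in> ?V \<and> remove_strand 0 ([1..<Suc k] @ u @ v) = u \<and>
        [] = v \<and> strand_cost a b 0 ([1..<Suc k] @ u @ v) = ?K"
      using word_perm_inflate_21(1)[OF u(1,3)] u v strand_low[OF u(1)] run inversion_number_inflate_21
      by (auto simp: strand_append reduced_words_iff)
    show "map Suc u @ [1..<Suc k] @ v \<in> ?V \<and> remove_strand 0 (map Suc u @ [1..<Suc k] @ v) = u \<and>
        [] = v \<and> strand_cost a b 0 (map Suc u @ [1..<Suc k] @ v) = 0"
      using word_perm_inflate_21(2)[OF u(1,3)] u v strand_high[OF u1] run inversion_number_inflate_21
      by (auto simp: strand_append reduced_words_iff)
  next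
    fix u v u' v' c d
    assume u: "connects a b u u' c" and v: "connects a b v v' d"
    show "connects a b ([1..<Suc k] @ u @ v) ([1..<Suc k] @ u' @ v') (c + d)"
      using connects_trans[OF connects_append_right[OF u] connects_append_left[OF v]]
      by (rule connects_append_left)
    show "connects a b (map Suc u @ [1..<Suc k] @ v) (map Suc u' @ [1..<Suc k] @ v') (c + d)"
      using connects_trans[OF connects_append_right[OF connects_shift[OF u, of 1]]
          connects_append_left[OF connects_append_left[OF v]]] by simp
  next
    fix x
    assume "x \<in> ?V"
    note x = reduced_wordsD[OF this] and x' = reduced_words_inflate_21[OF this]
    have xk: "set x \<subseteq> {1..k}" and x0: "0 \<notin> set x" using x(1) by auto
    show "\<exists>c d. c + d = ?K \<and> connects a b x ([1..<Suc k] @ remove_strand 0 x @ []) c \<and>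
        connects a b x (map Suc (remove_strand 0 x) @ [1..<Suc k] @ []) d"
      using connects_strand_left[OF xk x'(3,2)] reduced_wordsD(2)[OF x'(1)] by simp
    show "\<exists>c d. connects a b (remove_strand 0 x) (remove_strand 0 y) c \<and> connects a b [] [] d \<and>
        strand_cost a b 0 x + c + d \<le> strand_cost a b 0 y + a"
      if "(x, y) \<in> commutation_moves" for y
      using strand_commutation_move[OF that x0 x'(2)] connects.refl[of a b "[]"]
      by (metis add.right_neutral)
    show "\<exists>c d. connects a b (remove_strand 0 x) (remove_strand 0 y) c \<and> connects a b [] [] d \<and>
        strand_cost a b 0 x + c + d \<le> strand_cost a b 0 y + b"
      if "(x, y) \<in> braid_moves" for y
      using strand_braid_move[OF that x'(2)] connects.refl[of a b "[]"]
      by (metis add.right_neutral)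
  qed auto
  moreover have "word_diam a b {[]} = 0"
    by (simp add: word_diam_def word_dist_self)
  ultimately show ?thesis by simp
qed

end

section \<open>Decomposition of permutations avoiding 312\<close>

text \<open>Used with the identity and with a shift of positions, to pass 312-avoidance on to the
  two blocks.\<close>

lemma contains_pattern_embedding:
  assumes "contains_pattern k p' r q"
    and "strict_mono_on {1..k} f" "f ` {1..k} \<subseteq> {1..n}"
    and "\<And>i j. i \<in> {1..k} \<Longrightarrow> j \<in> {1..k} \<Longrightarrow> p (f i) < p (f j) \<longleftrightarrow> p' i < p' j"
  shows "contains_pattern n p r q"
proof -
  obtain e where e: "strict_mono_on {1..r} e" "e ` {1..r} \<subseteq> {1..k}"
    "\<forall>i\<in>{1..r}. \<forall>j\<in>{1..r}. p' (e i) < p' (e j) \<longleftrightarrow> q i < q j"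
    using assms(1) unfolding contains_pattern_def by blast
  have mem: "e i \<in> {1..k}" if "i \<in> {1..r}" for i
    using e(2) that by blast
  have "strict_mono_on {1..r} (f \<circ> e)"
    using e(1) assms(2) mem by (auto simp: strict_mono_on_def)
  moreover have "(f \<circ> e) ` {1..r} \<subseteq> {1..n}"
    using e(2) assms(3) by fastforce
  moreover have "\<forall>i\<in>{1..r}. \<forall>j\<in>{1..r}. p ((f \<circ> e) i) < p ((f \<circ> e) j) \<longleftrightarrow> q i < q j"
    using e(3) assms(4) mem by simp
  ultimately show ?thesis
    unfolding contains_pattern_def by blast
qed

lemma contains_312I:
  assumes "1 \<le> i" "i < j" "j < k" "k \<le> n" "p j < p k" "p k < p i"
  shows "contains_pattern n p 3 (one_line [3, 1, 2])"
  unfolding contains_pattern_def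
proof (intro exI conjI)
  let ?e = "\<lambda>t :: nat. if t = 1 then i else if t = 2 then j else k"
  have three: "{1..3::nat} = {1, 2, 3}" by auto
  show "strict_mono_on {1..3} ?e"
    using assms unfolding three by (auto simp: strict_mono_on_def)
  show "?e ` {1..3} \<subseteq> {1..n}"
    using assms by auto
  show "\<forall>s\<in>{1..3}. \<forall>t\<in>{1..3}. p (?e s) < p (?e t) \<longleftrightarrow> one_line [3, 1, 2] s < one_line [3, 1, 2] t"
    using assms unfolding three by (auto simp: one_line_def)
qed

lemma permutes_finiteI:
  assumes "finite S" "p ` S \<subseteq> S" "inj_on p S" "\<And>x. x \<notin> S \<Longrightarrow> p x = x"
  shows "p permutes S"
  using assms endo_inj_surj[OF assms(1-3)] by (intro bij_imp_permutes) (auto simp: bij_betw_def)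

text \<open>An entry before the 1 that exceeds an entry after it would form 312 with the 1 in the
  middle. So the entries up to the 1 are smaller than all later ones and fill an initial interval of
  values.\<close>

lemma avoids_312_decompose:
  assumes \<pi>: "\<pi> permutes {1..Suc k + l}" and avoids: "avoids_312 (Suc k + l) \<pi>"
    and one: "\<pi> (Suc k) = 1"
  obtains \<pi>' \<pi>'' where "\<pi>' permutes {1..k}" "avoids_312 k \<pi>'"
    "\<pi>'' permutes {1..l}" "avoids_312 l \<pi>''"
    "\<pi> = inflate_12 (Suc k) (inflate_21 k \<pi>' 1 id) l \<pi>''"
proof -
  let ?m = "Suc k" and ?n = "Suc k + l"
  have inj: "\<pi> i = \<pi> j \<longleftrightarrow> i = j" for i j
    using permutes_inj[OF \<pi>] by (simp add: inj_eq)
  have range: "\<pi> i \<in> {1..?n} \<longleftrightarrow> i \<in> {1..?n}" for i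
    by (rule permutes_in_image[OF \<pi>])
  have less: "\<pi> i < \<pi> j" if "1 \<le> i" "i \<le> ?m" "?m < j" "j \<le> ?n" for i j
  proof (cases "i = ?m")
    case True
    then show ?thesis using range[of j] inj[of j ?m] one that by auto
  next
    case False
    have "\<pi> ?m < \<pi> j" using range[of j] inj[of j ?m] one that by auto
    then have "\<not> \<pi> j < \<pi> i"
      using contains_312I[of i ?m j ?n \<pi>] avoids that False by auto
    then show ?thesis using inj[of i j] that by auto
  qed
  have low: "\<pi> i \<le> ?m" if "1 \<le> i" "i \<le> ?m" for i
  proof -
    \<comment> \<open>Values up to \<open>\<pi> i\<close> cannot occur after the 1, where everything
      is larger; counting them bounds \<open>\<pi> i\<close>.\<close>
    have "{1..\<pi> i} \<subseteq> \<pi> ` {1..?m}"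
    proof
      fix v assume v: "v \<in> {1..\<pi> i}"
      have "v \<in> \<pi> ` {1..?n}"
        using v range[of i] that permutes_image[OF \<pi>] by auto
      then obtain j where "j \<in> {1..?n}" "v = \<pi> j" by blast
      then show "v \<in> \<pi> ` {1..?m}"
        using less[of i j] v that by (cases "j \<le> ?m") auto
    qed
    from card_mono[OF _ this] have "\<pi> i \<le> card (\<pi> ` {1..?m})" by simp
    also have "\<dots> \<le> ?m" using card_image_le[of "{1..?m}" \<pi>] by simp
    finally show ?thesis .
  qed
  have "inj_on \<pi> {1..?m}" using inj by (auto simp: inj_on_def)
  moreover have "\<pi> ` {1..?m} \<subseteq> {1..?m}"
  proof (rule image_subsetI)
    fix i assume "i \<in> {1..?m}"
    then show "\<pi> i \<in> {1..?m}" using low[of i] range[of i] by simp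
  qed
  ultimately have image: "\<pi> ` {1..?m} = {1..?m}"
    by (intro endo_inj_surj) auto
  have high: "?m < \<pi> i" if "?m < i" "i \<le> ?n" for i
  proof (rule ccontr)
    assume "\<not> ?m < \<pi> i"
    then have "\<pi> i \<in> \<pi> ` {1..?m}"
      unfolding image using range[of i] that by auto
    then show False using inj that by auto
  qed
  have low': "2 \<le> \<pi> i" if "1 \<le> i" "i \<le> k" for i
    using range[of i] inj[of i ?m] one that by auto
  define \<pi>' where "\<pi>' i = (if i \<in> {1..k} then \<pi> i - 1 else i)" for i
  define \<pi>'' where "\<pi>'' i = (if i \<in> {1..l} then \<pi> (i + ?m) - ?m else i)" for i
  have \<pi>': "\<pi>' i = \<pi> i - 1" "2 \<le> \<pi> i" "\<pi> i \<le> ?m" if "i \<in> {1..k}" for i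
    using low[of i] low'[of i] that by (auto simp: \<pi>'_def)
  have \<pi>'': "\<pi>'' i = \<pi> (i + ?m) - ?m" "?m < \<pi> (i + ?m)" "\<pi> (i + ?m) \<le> ?n" if "i \<in> {1..l}" for i
    using high[of "i + ?m"] range[of "i + ?m"] that by (auto simp: \<pi>''_def)
  show ?thesis
  proof
    show "\<pi>' permutes {1..k}"
    proof (rule permutes_finiteI)
      show "inj_on \<pi>' {1..k}"
      proof (rule inj_onI)
        fix i j assume "i \<in> {1..k}" "j \<in> {1..k}" "\<pi>' i = \<pi>' j"
        then show "i = j" using \<pi>'[of i] \<pi>'[of j] inj[of i j] by linarith
      qed
      show "\<pi>' ` {1..k} \<subseteq> {1..k}"
      proof (rule image_subsetI)
        fix i assume "i \<in> {1..k}"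
        then show "\<pi>' i \<in> {1..k}" using \<pi>'[of i] unfolding atLeastAtMost_iff by linarith
      qed
    qed (auto simp: \<pi>'_def)
    show "\<pi>'' permutes {1..l}"
    proof (rule permutes_finiteI)
      show "inj_on \<pi>'' {1..l}"
      proof (rule inj_onI)
        fix i j assume "i \<in> {1..l}" "j \<in> {1..l}" "\<pi>'' i = \<pi>'' j"
        then show "i = j" using \<pi>''[of i] \<pi>''[of j] inj[of "i + ?m" "j + ?m"] by linarith
      qed
      show "\<pi>'' ` {1..l} \<subseteq> {1..l}"
      proof (rule image_subsetI)
        fix i assume "i \<in> {1..l}"
        then show "\<pi>'' i \<in> {1..l}" using \<pi>''[of i] unfolding atLeastAtMost_iff by linarith
      qed
    qed (auto simp: \<pi>''_def)
    show "avoids_312 k \<pi>'"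
    proof
      assume "contains_pattern k \<pi>' 3 (one_line [3, 1, 2])"
      then have "contains_pattern ?n \<pi> 3 (one_line [3, 1, 2])"
      proof (rule contains_pattern_embedding[where f = "\<lambda>i. i"])
        fix i j assume "i \<in> {1..k}" "j \<in> {1..k}"
        then show "\<pi> i < \<pi> j \<longleftrightarrow> \<pi>' i < \<pi>' j" using \<pi>'[of i] \<pi>'[of j] by auto
      qed (auto simp: strict_mono_on_def)
      then show False using avoids by contradiction
    qed
    show "avoids_312 l \<pi>''"
    proof
      assume "contains_pattern l \<pi>'' 3 (one_line [3, 1, 2])"
      then have "contains_pattern ?n \<pi> 3 (one_line [3, 1, 2])"
      proof (rule contains_pattern_embedding[where f = "\<lambda>i. i + ?m"])
        fix i j assume "i \<in> {1..l}" "j \<in> {1..l}"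
        then show "\<pi> (i + ?m) < \<pi> (j + ?m) \<longleftrightarrow> \<pi>'' i < \<pi>'' j" using \<pi>''[of i] \<pi>''[of j] by auto
      qed (auto simp: strict_mono_on_def)
      then show False using avoids by contradiction
    qed
    show "\<pi> = inflate_12 ?m (inflate_21 k \<pi>' 1 id) l \<pi>''"
    proof
      fix i
      consider "i \<in> {1..k}" | "i = ?m" | "i - ?m \<in> {1..l}" "?m < i" | "i \<notin> {1..?n}"
        by fastforce
      then show "\<pi> i = inflate_12 ?m (inflate_21 k \<pi>' 1 id) l \<pi>'' i"
      proof cases
        case 1
        then show ?thesis using \<pi>'[of i] by (simp add: inflate_12_def inflate_21_def)
      next
        case 2
        then show ?thesis using one by (simp add: inflate_12_def inflate_21_def)
      next
        case 3
        then show ?thesis using \<pi>''[of "i - ?m"] by (auto simp: inflate_12_def)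
      next
        case 4
        then show ?thesis using permutes_not_in[OF \<pi>, of i] by (auto simp: inflate_12_def)
      qed
    qed
  qed
qed

text \<open>The first summand of the constant comes from 21[p, 1], the second from the direct sum,
  in which 21[p, 1] contributes l(p) + k inversions.\<close>

lemma word_diam_decomposition:
  assumes p: "p permutes {1..k}" and q: "q permutes {1..l}"
  shows "word_diam a b (reduced_words (Suc k + l) (inflate_12 (Suc k) (inflate_21 k p 1 id) l q)) =
    word_diam a b (reduced_words k p) + word_diam a b (reduced_words l q) +
    ereal (real (inversion_number k p) * ((real k - 2) * real a + real b) +
      (real (inversion_number k p) + real k) * real (inversion_number l q) * real a)"
proof -
  have trunc: "real (inversion_number k p * ((k - 2) * a + b)) =
      real (inversion_number k p) * ((real k - 2) * real a + real b)"
  proof (cases "2 \<le> k")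
    case True
    then show ?thesis by (simp add: of_nat_diff)
  next
    \<comment> \<open>For k < 2 the truncated and the real value of k - 2 differ, but
      \<open>p\<close> has no inversions and both sides vanish.\<close>
    case False
    then have "{(i, j). i \<in> {1..k} \<and> j \<in> {1..k} \<and> i < j \<and> p j < p i} = {}" by auto
    then have "inversion_number k p = 0" unfolding inversion_number_def by (simp only: card.empty)
    then show ?thesis by simp
  qed
  show ?thesis
    unfolding word_diam_inflate_12[OF inflate_21_permutes[OF p] q] word_diam_inflate_21[OF p]
      inversion_number_inflate_21[OF p] trunc
    by (simp add: ac_simps)
qed

theorem theorem5p4:
  fixes n m :: nat and \<pi> :: "nat \<Rightarrow> nat"
  assumes "\<pi> permutes {1..n}"
    and "avoids_312 n \<pi>"
    and "m \<in> {1..n}"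
    and "\<pi> m = 1"
  shows "\<exists>\<pi>' \<pi>''.
      \<pi>' permutes {1..m - 1} \<and> avoids_312 (m - 1) \<pi>' \<and>
      \<pi>'' permutes {1..n - m} \<and> avoids_312 (n - m) \<pi>'' \<and>
      \<pi> = inflate_12 m (inflate_21 (m - 1) \<pi>' 1 id) (n - m) \<pi>'' \<and>
      (let l' = real (inversion_number (m - 1) \<pi>');
           l'' = real (inversion_number (n - m) \<pi>'')
       in diameter_of (word_graph n \<pi>) =
            diameter_of (word_graph (m - 1) \<pi>') + diameter_of (word_graph (n - m) \<pi>'')
            + ereal ((real m - 1) * (l' + l'') + l' * (l'' - 1)) \<and>
          diameter_of (commutation_contracted_graph n \<pi>) =
            diameter_of (commutation_contracted_graph (m - 1) \<pi>')
            + diameter_of (commutation_contracted_graph (n - m) \<pi>'')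
            + ereal l' \<and>
          diameter_of (braid_contracted_graph n \<pi>) =
            diameter_of (braid_contracted_graph (m - 1) \<pi>')
            + diameter_of (braid_contracted_graph (n - m) \<pi>'')
            + ereal ((real m - 1) * (l' + l'') + l' * (l'' - 2)))"
proof -
  define k l where "k = m - 1" and "l = n - m"
  have m: "m = Suc k" and n: "n = Suc k + l"
    using assms(3) by (auto simp: k_def l_def)
  obtain \<pi>' \<pi>'' where *: "\<pi>' permutes {1..k}" "avoids_312 k \<pi>'"
    "\<pi>'' permutes {1..l}" "avoids_312 l \<pi>''"
    "\<pi> = inflate_12 (Suc k) (inflate_21 k \<pi>' 1 id) l \<pi>''"
    using avoids_312_decompose[of \<pi> k l] assms unfolding m n by blast
  \<comment> \<open>One formula serves all three claims. For costs (1, 1) the constant l' (k - 1) +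
    (l' + k) l'' regroups to k (l' + l'') + l' (l'' - 1); for (1, 0) the factor k - 1 becomes k - 2;
    for (0, 1) only l' remains.\<close>
  note diam = word_diam_decomposition[OF *(1,3), folded *(5) n]
  show ?thesis
    unfolding k_def[symmetric] l_def[symmetric] Let_def diameter_of_word_graph
      diameter_of_commutation_contracted_graph diameter_of_braid_contracted_graph diam
    using * by (intro exI[of _ \<pi>'] exI[of _ \<pi>'']) (simp add: m algebra_simps)
qed

end
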